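(* Let $\mathcal M$ be a class of environments and let $\varepsilon>0$. Let $\tau,M,H,N$ be AIQI parameters with $$\tau\le\frac{\varepsilon(1-\gamma)}{10},\qquad M\ge\frac{10}{\varepsilon(1-\gamma)},\qquad H=H(\eta)\ \text{ for some } 0<\eta\le\frac{\varepsilon(1-\gamma)}{10},\qquad N\ge H+\log_\gamma\frac{\varepsilon}{5}.$$ Suppose $\psi$ is a unified return-predictor that has a grain of truth with respect to every environment $\nu\in\mathcal M$ (for the parameters $H,M,N,\tau$). Then the AIQI policy $\pi=\hat\pi^{H,M,N,\tau}_\psi$ is strong asymptotically $\varepsilon$-optimal in $\mathcal M$, i.e. for every $\nu\in\mathcal M$, $$\limsup_{t\to\infty}\bigl(V^\ast_\nu(h_{<t})-V^\pi_\nu(h_{<t})\bigr)\le\varepsilon\qquad \nu^\pi\text{-almost surely}.$$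
   Context: **General RL.** $\mathcal A$, $\mathcal O$ are finite nonempty sets (actions, observations), $\mathcal R\subseteq[0,1]$ is a finite set of rewards, $\mathcal E=\mathcal O\times\mathcal R$ is the set of percepts; $r_t$ is the reward component of $e_t$. A history is $h_{1:t}=a_1e_1\dots a_te_t$, $h_{<t}=h_{1:t-1}$, $\mathcal H=(\mathcal A\times\mathcal E)^*$, and $\Omega=(\mathcal A\times\mathcal E)^\infty$ is the set of outcomes $h$. A policy is a map $\pi:\mathcal H\to\Delta\mathcal A$, an environment is a map $\nu:\mathcal H\times\mathcal A\to\Delta\mathcal E$ ($\Delta X$ = probability distributions on $X$). $\nu^\pi$ is the probability measure on $\Omega$ with $\nu^\pi(h_{1:t})=\prod_{i\le t}\pi(a_i\mid h_{<i})\,\nu(e_i\mid h_{<i}a_i)$. Conditional probabilities/expectations given $h_{<t}$ or $h_{<t}a_t$ are those obtained by continuing the interaction from there with $\pi$ and $\nu$. Fix a discount $\gamma\in(0,1)$. The return is $R_t=(1-\gamma)\sum_{k\ge0}\gamma^kr_{t+k}$, the $H$-step return is $R_{t,H}=(1-\gamma)\sum_{k=0}^{H-1}\gamma^kr_{t+k}$; $V^\pi_\nu(h_{<t})=\mathbb E^\pi_\nu[R_t\mid h_{<t}]$, $Q^\pi_\nu(h_{<t},a_t)=\mathbb E^\pi_\nu[R_t\mid h_{<t}a_t]$, $V^\ast_\nu=\sup_\pi V^\pi_\nu$. For $\eta>0$ the $\eta$-effective horizon is $H(\eta)=\min\{H\in\mathbb Z_+: (1-\gamma)\sum_{k\ge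 H}\gamma^k\le\eta\}$. **Augmented histories.** AIQI parameters: $H\in\mathbb Z_+$ (return horizon), $M\in\mathbb Z_+$ (discretization level), $N\in\mathbb Z_+$ with $N\ge H$ (augmentation period), $\tau\in(0,1]$ (exploration rate). The discretized return is $z_t=\lfloor M R_{t,H}\rfloor/M\in\mathcal Z:=\{0,\frac1M,\dots,\frac{M-1}M\}$. For a phase $n\in\{0,\dots,N-1\}$, the augmented sample space is $\tilde\Omega^{(n)}=\prod_{i\ge1}\mathcal B^{(n)}_i$ with $\mathcal B^{(n)}_i=\mathcal A\times\mathcal Z\times\mathcal E$ if $i\equiv n\pmod N$ and $\mathcal A\times\mathcal E$ otherwise; so an augmented outcome $\tilde h^{(n)}$ has an extra symbol $\tilde z_i\in\mathcal Z$ (not required to equal the true $z_i$) between $a_i$ and $e_i$ for each $i\equiv n$. $\tilde h^{(n)}_{<t}$ denotes its prefix consisting of blocks $1,\dots,t-1$, and $h_{<t}$ is obtained from it by deleting the symbols $\tilde z_i$. The map $\mathrm{aug}_n:\Omega\to\tilde\Omega^{(n)}$ inserts the true values $z_i$ (computed from the rewards $r_i,\dots,r_{i+H-1}$ of $h$) at all positions $i\equiv n\pmod N$. If $(t-1-n)\bmod N\ge H-1$ (in particular if $n=t\bmod N$), $\mathrm{aug}_n(h)_{<t}$ depends only on $h_{<t}$, and is written $\mathrm{aug}_n(h_{<t})$. **Return-predictors.** A phase-$n$ return-predictor is a map $\phi$ assigning to each pair ($\tilde h^{(n)}_{<i},a_i$) with $i\equiv n\pmod N$ a distribution $\phi(\cdot\mid\tilde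 h^{(n)}_{<i}a_i)\in\Delta\mathcal Z$. Given a countable class $\mathcal P_n$ of phase-$n$ return-predictors and prior weights $\omega_n(\phi)>0$ summing to 1, the mixture $\psi_n$ is the phase-$n$ return-predictor with $\prod_{k=0}^K\psi_n(\tilde z_{i_k}\mid\tilde h^{(n)}_{<i_k}a_{i_k})=\sum_{\phi\in\mathcal P_n}\omega_n(\phi)\prod_{k=0}^K\phi(\tilde z_{i_k}\mid\tilde h^{(n)}_{<i_k}a_{i_k})$ for all $K\ge0$ and all augmented histories, where $i_0<i_1<\dots$ enumerate the positive integers $\equiv n\pmod N$. A unified return-predictor $\psi$ is given by mixtures $\psi_0,\dots,\psi_{N-1}$ via $\psi(\tilde z_t\mid h_{<t}a_t)=\psi_n(\tilde z_t\mid\mathrm{aug}_n(h_{<t})a_t)$ with $n=t\bmod N$. **AIQI.** Let $\hat Q(h_{<t},a_t)=\sum_{\tilde z\in\mathcal Z}\tilde z\,\psi(\tilde z\mid h_{<t}a_t)$. The AIQI policy $\hat\pi^{H,M,N,\tau}_\psi$ is $\hat\pi(a\mid h_{<t})=(1-\tau)\mathbf 1[a=a^\ast]+\tau/|\mathcal A|$ with $a^\ast=\arg\max_{a}\hat Q(h_{<t},a)$, where stochastic tie-breaking is allowed (the indicator may be replaced by any probability distribution supported on the maximizers of $\hat Q(h_{<t},\cdot)$). **Grain of truth.** With $\hat\pi=\hat\pi^{H,M,N,\tau}_\psi$, $\psi$ has a grain of truth w.r.t. $\nu$ if for every $n$ the class $\mathcal P_n$ of the mixture $\psi_n$ contains the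 return-predictor $\phi^\ast(\tilde z_i\mid\tilde h^{(n)}_{<i}a_i)=\nu^{\hat\pi}(z_i=\tilde z_i\mid h_{<i}a_i)$, $i\equiv n\pmod N$. *)

theory Defs
  imports "HOL-Probability.Probability"
begin

text \<open>
  Actions, observations and rewards are finite types. A reward symbol \<open>r\<close> has the real value
  \<open>rew r\<close>; the theorem assumes \<open>rew\<close> to be injective with values in the unit interval, so that
  \<open>range rew\<close> is an arbitrary finite nonempty set of rewards. A block is an action followed by a
  percept. Time is 1-based: block \<open>i\<close> of a history \<open>h\<close> is \<open>h ! (i - 1)\<close>,
  and a history of length \<open>t - 1\<close> is the one before time \<open>t\<close>.
\<close>

type_synonym ('a, 'o, 'r) block = "'a \<times> 'o \<times> 'r"
type_synonym ('a, 'o, 'r) history = "('a, 'o, 'r) block list"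
type_synonym ('a, 'o, 'r) outcome = "nat \<Rightarrow> ('a, 'o, 'r) block"
type_synonym ('a, 'o, 'r) policy = "('a, 'o, 'r) history \<Rightarrow> 'a pmf"
type_synonym ('a, 'o, 'r) environment = "('a, 'o, 'r) history \<Rightarrow> 'a \<Rightarrow> ('o \<times> 'r) pmf"

definition history_before :: "('a, 'o, 'r) outcome \<Rightarrow> nat \<Rightarrow> ('a, 'o, 'r) history" where
  "history_before \<omega> t = map \<omega> [0..<t - 1]"


subsection \<open>Interaction of a policy with an environment\<close>

definition block_pmf ::
  "('a, 'o, 'r) policy \<Rightarrow> ('a, 'o, 'r) environment \<Rightarrow> ('a, 'o, 'r) history \<Rightarrow> ('a, 'o, 'r) block pmf" where
  "block_pmf \<pi> \<nu> h = bind_pmf (\<pi> h) (\<lambda>a. map_pmf (\<lambda>e. (a, e)) (\<nu> h a))"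

text \<open>
  \<open>interaction \<pi> \<nu> h\<close> is the law of the blocks that follow the history \<open>h\<close> (so coordinate 0 is the
  block at time \<open>length h + 1\<close>) when \<open>\<pi>\<close> interacts with \<open>\<nu>\<close> from \<open>h\<close> on; it is the Ionescu-Tulcea
  limit of the one-step kernels. The measure on outcomes is \<open>interaction \<pi> \<nu> []\<close>.
\<close>

definition interaction ::
  "('a, 'o, 'r) policy \<Rightarrow> ('a, 'o, 'r) environment \<Rightarrow> ('a, 'o, 'r) history \<Rightarrow> ('a, 'o, 'r) outcome measure" where
  "interaction \<pi> \<nu> h =
     projective_family.lim UNIV
       (Ionescu_Tulcea.CI (\<lambda>i \<omega>. measure_pmf (block_pmf \<pi> \<nu> (h @ map \<omega> [0..<i]))) (\<lambda>_. count_space UNIV))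
       (\<lambda>_. count_space UNIV)"

text \<open>
  Conditioning on \<open>h\<close> and the next action \<open>a\<close>: the policy is only changed at \<open>h\<close> itself, which is
  never revisited.
\<close>

definition interaction_act ::
  "('a, 'o, 'r) policy \<Rightarrow> ('a, 'o, 'r) environment \<Rightarrow> ('a, 'o, 'r) history \<Rightarrow> 'a \<Rightarrow> ('a, 'o, 'r) outcome measure" where
  "interaction_act \<pi> \<nu> h a = interaction (\<pi>(h := return_pmf a)) \<nu> h"

lemma pmf_block_pmf: "pmf (block_pmf \<pi> \<nu> h) (a, e) = pmf (\<pi> h) a * pmf (\<nu> h a) e"
proof -
  have "pmf (map_pmf (\<lambda>e. (b, e)) (\<nu> h b)) (a, e) = indicator {a} b * pmf (\<nu> h a) e" for b
  proof (cases "b = a")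
    case True
    have "inj (\<lambda>e. (a, e))" by (auto intro: injI)
    from pmf_map_inj'[OF this, of "\<nu> h a" e] True show ?thesis by simp
  next
    case False
    then have "(a, e) \<notin> set_pmf (map_pmf (\<lambda>e. (b, e)) (\<nu> h b))" by auto
    then have "pmf (map_pmf (\<lambda>e. (b, e)) (\<nu> h b)) (a, e) = 0" by (simp only: set_pmf_iff) simp
    then show ?thesis using False by simp
  qed
  then show ?thesis
    by (simp add: block_pmf_def pmf_bind measure_pmf_single)
qed

lemma Ionescu_Tulcea_interaction:
  fixes \<pi> :: "('a::finite, 'o::finite, 'r::finite) policy"
  shows "Ionescu_Tulcea (\<lambda>i \<omega>. measure_pmf (block_pmf \<pi> \<nu> (h @ map \<omega> [0..<i]))) (\<lambda>_. count_space UNIV)"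
proof (rule Ionescu_Tulcea.intro)
  fix i :: nat
  let ?C = "count_space UNIV :: ('a, 'o, 'r) block measure"
  have eq: "PiM {0..<i} (\<lambda>_. ?C) = count_space (PiE {0..<i} (\<lambda>_. UNIV))"
    by (rule count_space_PiM_finite) simp_all
  show "(\<lambda>\<omega>. measure_pmf (block_pmf \<pi> \<nu> (h @ map \<omega> [0..<i])))
      \<in> measurable (PiM {0..<i} (\<lambda>_. ?C)) (subprob_algebra ?C)"
    unfolding eq by (auto simp: measure_pmf_in_subprob_algebra)
next
  fix i :: nat and \<omega> :: "('a, 'o, 'r) outcome"
  show "prob_space (measure_pmf (block_pmf \<pi> \<nu> (h @ map \<omega> [0..<i])))"
    by (rule prob_space_measure_pmf)
qed


lemma prob_space_interaction:
  fixes \<pi> :: "('a::finite, 'o::finite, 'r::finite) policy"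
  shows "prob_space (interaction \<pi> \<nu> h)"
proof -
  interpret IT: Ionescu_Tulcea "\<lambda>i \<omega>. measure_pmf (block_pmf \<pi> \<nu> (h @ map \<omega> [0..<i]))" "\<lambda>_. count_space UNIV"
    by (rule Ionescu_Tulcea_interaction)
  have "emeasure IT.PF.lim (IT.PF.emb UNIV {} (space (PiM {} (\<lambda>_. count_space UNIV))))
      = emeasure (IT.CI {}) (space (PiM {} (\<lambda>_. count_space UNIV)))"
    by (rule IT.lim) auto
  also have "\<dots> = 1"
    using IT.PF.prob_space_P[of "{}"] IT.PF.sets_P[of "{}"]
    by (metis finite.emptyI prob_space.emeasure_space_1 sets_eq_imp_space_eq subset_UNIV)
  finally have "emeasure IT.PF.lim (space IT.PF.lim) = 1"
    by (simp add: prod_emb_def space_PiM vimage_def restrict_def)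
  then show ?thesis
    unfolding interaction_def by (rule prob_spaceI)
qed

theorem emeasure_interaction_cylinder:
  fixes \<pi> :: "('a::finite, 'o::finite, 'r::finite) policy"
  shows "emeasure (interaction \<pi> \<nu> h) {\<omega>. map \<omega> [0..<length g] = g} =
    (\<Prod>i<length g. pmf (\<pi> (h @ take i g)) (fst (g ! i)) * pmf (\<nu> (h @ take i g) (fst (g ! i))) (snd (g ! i)))"
proof -
  let ?C = "count_space UNIV :: ('a, 'o, 'r) block measure"
  interpret IT: Ionescu_Tulcea "\<lambda>i \<omega>. measure_pmf (block_pmf \<pi> \<nu> (h @ map \<omega> [0..<i]))" "\<lambda>_. ?C"
    by (rule Ionescu_Tulcea_interaction)
  define x where "x n = restrict ((!) g) {0..<n}" for n
  define p where "p i = pmf (block_pmf \<pi> \<nu> (h @ take i g)) (g ! i)" for i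
  have Pi: "PiM {0..<n} (\<lambda>_. ?C) = count_space (PiE {0..<n} (\<lambda>_. UNIV))" for n :: nat
    by (rule count_space_PiM_finite) simp_all
  have xm: "{x n} \<in> sets (PiM {0..<n} (\<lambda>_. ?C))" for n
    unfolding Pi by (auto simp: x_def)
  have C: "emeasure (IT.C 0 n (\<lambda>_. undefined)) {x n} = ennreal (\<Prod>i<n. p i)" if "n \<le> length g" for n
    using that
  proof (induction n)
    case 0
    have "x 0 = (\<lambda>_. undefined)" by (auto simp: x_def)
    with xm[of 0] show ?case by (simp add: emeasure_return)
  next
    case (Suc n)
    have sp: "space (IT.C 0 n (\<lambda>_. undefined)) = PiE {0..<n} (\<lambda>_. UNIV)"
      by (subst IT.space_C) (auto simp: space_PiM)
    have st: "sets (IT.C 0 n (\<lambda>_. undefined)) = sets (PiM {0..<n} (\<lambda>_. ?C))"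
      by (subst IT.sets_C) (auto simp: space_PiM)
    have step: "emeasure (IT.eP n \<omega>) {x (Suc n)} = ennreal (p n) * indicator {x n} \<omega>"
      if w: "\<omega> \<in> PiE {0..<n} (\<lambda>_. UNIV)" for \<omega>
    proof -
      have "emeasure (IT.eP n \<omega>) {x (Suc n)} =
        emeasure (measure_pmf (block_pmf \<pi> \<nu> (h @ map \<omega> [0..<n]))) ((\<lambda>y. fun_upd \<omega> n y) -` {x (Suc n)} \<inter> space ?C)"
        by (rule IT.emeasure_eP[OF _ xm]) (use w in \<open>simp add: space_PiM\<close>)
      also have "(\<lambda>y. fun_upd \<omega> n y) -` {x (Suc n)} \<inter> space ?C = (if \<omega> = x n then {g ! n} else {})"
      proof -
        have "fun_upd \<omega> n y = x (Suc n) \<longleftrightarrow> \<omega> = x n \<and> y = g ! n" for y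
        proof
          assume a: "fun_upd \<omega> n y = x (Suc n)"
          have "y = g ! n" using fun_cong[OF a, of n] by (simp add: x_def)
          moreover have "\<omega> i = x n i" for i
            using fun_cong[OF a, of i] w by (cases "i = n") (auto simp: x_def PiE_def extensional_def)
          ultimately show "\<omega> = x n \<and> y = g ! n" by auto
        next
          assume "\<omega> = x n \<and> y = g ! n"
          then show "fun_upd \<omega> n y = x (Suc n)" by (auto simp: x_def fun_eq_iff)
        qed
        then show ?thesis by auto
      qed
      also have "emeasure (measure_pmf (block_pmf \<pi> \<nu> (h @ map \<omega> [0..<n]))) (if \<omega> = x n then {g ! n} else {})
        = ennreal (p n) * indicator {x n} \<omega>"
      proof (cases "\<omega> = x n")
        case True
        have "map (x n) [0..<n] = take n g"
          using Suc.prems by (intro nth_equalityI) (auto simp: x_def)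
        with True show ?thesis by (simp add: p_def emeasure_pmf_single)
      qed auto
      finally show ?thesis .
    qed
    have "emeasure (IT.C 0 (Suc n) (\<lambda>_. undefined)) {x (Suc n)} =
      (\<integral>\<^sup>+\<omega>. emeasure (IT.eP n \<omega>) {x (Suc n)} \<partial>IT.C 0 n (\<lambda>_. undefined))"
      using IT.measurable_eP[of n] xm[of "Suc n"] sp st
      by (simp, subst emeasure_bind[where N = "PiM {0..<Suc n} (\<lambda>_. ?C)"])
         (auto simp: measurable_cong_sets[OF st refl])
    also have "\<dots> = (\<integral>\<^sup>+\<omega>. ennreal (p n) * indicator {x n} \<omega> \<partial>IT.C 0 n (\<lambda>_. undefined))"
      by (intro nn_integral_cong step) (simp add: sp)
    also have "\<dots> = ennreal (p n) * emeasure (IT.C 0 n (\<lambda>_. undefined)) {x n}"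
      using xm[of n] st by (intro nn_integral_cmult_indicator) simp
    also have "\<dots> = ennreal (\<Prod>i<Suc n. p i)"
      using Suc by (simp add: ennreal_mult'[symmetric] mult.commute p_def)
    finally show ?case .
  qed
  let ?n = "length g"
  have "map \<omega> [0..<?n] = g \<longleftrightarrow> restrict \<omega> {0..<?n} = x ?n" for \<omega>
  proof
    assume "map \<omega> [0..<?n] = g"
    then have "\<omega> i = g ! i" if "i < ?n" for i
      using that by (metis add_0 diff_zero length_upt nth_map nth_upt)
    then show "restrict \<omega> {0..<?n} = x ?n" by (auto simp: x_def restrict_def)
  next
    assume eq: "restrict \<omega> {0..<?n} = x ?n"
    have "\<omega> i = g ! i" if "i < ?n" for i
      using fun_cong[OF eq, of i] that by (simp add: x_def)
    then show "map \<omega> [0..<?n] = g" by (intro nth_equalityI) auto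
  qed
  then have "{\<omega>. map \<omega> [0..<?n] = g} = IT.PF.emb UNIV {0..<?n} {x ?n}"
    by (simp add: prod_emb_def space_PiM vimage_def)
  then have "emeasure (interaction \<pi> \<nu> h) {\<omega>. map \<omega> [0..<?n] = g} = emeasure (IT.CI {0..<?n}) {x ?n}"
    unfolding interaction_def using IT.lim[OF _ xm, of ?n] by simp
  also have "\<dots> = emeasure (IT.C 0 ?n (\<lambda>_. undefined)) (IT.PF.emb {0..<?n} {0..<?n} {x ?n})"
    by (rule IT.emeasure_CI[OF _ xm]) simp
  also have "IT.PF.emb {0..<?n} {0..<?n} {x ?n} = {x ?n}"
    by (intro prod_emb_id) (auto simp: x_def)
  also have "emeasure (IT.C 0 ?n (\<lambda>_. undefined)) {x ?n} = (\<Prod>i<?n. p i)"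
    by (rule C) simp
  finally have "emeasure (interaction \<pi> \<nu> h) {\<omega>. map \<omega> [0..<?n] = g} = (\<Prod>i<?n. p i)" .
  moreover have "p i = pmf (\<pi> (h @ take i g)) (fst (g ! i)) * pmf (\<nu> (h @ take i g) (fst (g ! i))) (snd (g ! i))" for i
    unfolding p_def by (metis pmf_block_pmf prod.collapse)
  ultimately show ?thesis by simp
qed


subsection \<open>Returns and values\<close>

text \<open>
  In the following definitions \<open>\<omega>\<close> lists the blocks from the current time on, so that coordinate
  \<open>k\<close> carries the reward \<open>k\<close> steps ahead.
\<close>

definition reward_at :: "('r \<Rightarrow> real) \<Rightarrow> ('a, 'o, 'r) outcome \<Rightarrow> nat \<Rightarrow> real" where
  "reward_at rew \<omega> k = rew (snd (snd (\<omega> k)))"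

definition total_return :: "('r \<Rightarrow> real) \<Rightarrow> real \<Rightarrow> ('a, 'o, 'r) outcome \<Rightarrow> real" where
  "total_return rew \<gamma> \<omega> = (1 - \<gamma>) * (\<Sum>k. \<gamma> ^ k * reward_at rew \<omega> k)"

definition truncated_return :: "('r \<Rightarrow> real) \<Rightarrow> real \<Rightarrow> nat \<Rightarrow> ('a, 'o, 'r) outcome \<Rightarrow> real" where
  "truncated_return rew \<gamma> H \<omega> = (1 - \<gamma>) * (\<Sum>k<H. \<gamma> ^ k * reward_at rew \<omega> k)"

definition policy_value ::
  "('r \<Rightarrow> real) \<Rightarrow> real \<Rightarrow> ('a, 'o, 'r) policy \<Rightarrow> ('a, 'o, 'r) environment \<Rightarrow> ('a, 'o, 'r) history \<Rightarrow> real" where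
  "policy_value rew \<gamma> \<pi> \<nu> h = (\<integral>\<omega>. total_return rew \<gamma> \<omega> \<partial>interaction \<pi> \<nu> h)"

definition optimal_value ::
  "('r \<Rightarrow> real) \<Rightarrow> real \<Rightarrow> ('a, 'o, 'r) environment \<Rightarrow> ('a, 'o, 'r) history \<Rightarrow> real" where
  "optimal_value rew \<gamma> \<nu> h = (SUP \<pi>. policy_value rew \<gamma> \<pi> \<nu> h)"

definition effective_horizon :: "real \<Rightarrow> real \<Rightarrow> nat" where
  "effective_horizon \<gamma> \<eta> = (LEAST H. 1 \<le> H \<and> (1 - \<gamma>) * (\<Sum>k. \<gamma> ^ (k + H)) \<le> \<eta>)"

definition strong_asymptotically_optimal ::
  "('r \<Rightarrow> real) \<Rightarrow> real \<Rightarrow> real \<Rightarrow> ('a, 'o, 'r) environment set \<Rightarrow> ('a, 'o, 'r) policy \<Rightarrow> bool" where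
  "strong_asymptotically_optimal rew \<gamma> \<epsilon> \<M> \<pi> \<longleftrightarrow>
     (\<forall>\<nu>\<in>\<M>. AE \<omega> in interaction \<pi> \<nu> [].
        limsup (\<lambda>t. ereal (optimal_value rew \<gamma> \<nu> (history_before \<omega> t)
                         - policy_value rew \<gamma> \<pi> \<nu> (history_before \<omega> t))) \<le> ereal \<epsilon>)"

lemma policy_value_bounds:
  fixes \<pi> :: "('a::finite, 'o::finite, 'r::finite) policy"
  assumes "0 < \<gamma>" "\<gamma> < 1" "range rew \<subseteq> {0..1}"
  shows "0 \<le> policy_value rew \<gamma> \<pi> \<nu> h" and "policy_value rew \<gamma> \<pi> \<nu> h \<le> 1"
proof -
  have r: "0 \<le> reward_at rew \<omega> k" "reward_at rew \<omega> k \<le> 1" for \<omega> :: "('a, 'o, 'r) outcome" and k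
    using assms(3) by (auto simp: reward_at_def image_subset_iff)
  have le: "\<gamma> ^ k * reward_at rew \<omega> k \<le> \<gamma> ^ k" for \<omega> :: "('a, 'o, 'r) outcome" and k
    using assms(1) r[of \<omega> k] by (intro mult_left_le) auto
  have geo: "summable (\<lambda>k. \<gamma> ^ k)" "(\<Sum>k. \<gamma> ^ k) = 1 / (1 - \<gamma>)"
    using assms by (auto intro: summable_geometric simp: suminf_geometric)
  have sm: "summable (\<lambda>k. \<gamma> ^ k * reward_at rew \<omega> k)" for \<omega> :: "('a, 'o, 'r) outcome"
    using assms(1) r le by (intro summable_comparison_test'[OF geo(1), of 0]) auto
  have nn: "0 \<le> total_return rew \<gamma> \<omega>" for \<omega> :: "('a, 'o, 'r) outcome"
    using assms r by (auto simp: total_return_def intro!: mult_nonneg_nonneg suminf_nonneg sm)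
  have ub: "total_return rew \<gamma> \<omega> \<le> 1" for \<omega> :: "('a, 'o, 'r) outcome"
  proof -
    have "(\<Sum>k. \<gamma> ^ k * reward_at rew \<omega> k) \<le> 1 / (1 - \<gamma>)"
      using suminf_le[OF le sm geo(1)] geo(2) by simp
    then have "(1 - \<gamma>) * (\<Sum>k. \<gamma> ^ k * reward_at rew \<omega> k) \<le> (1 - \<gamma>) * (1 / (1 - \<gamma>))"
      using assms by (intro mult_left_mono) auto
    then show ?thesis using assms by (simp add: total_return_def)
  qed
  show "0 \<le> policy_value rew \<gamma> \<pi> \<nu> h"
    unfolding policy_value_def using nn by (intro Bochner_Integration.integral_nonneg) auto
  interpret prob_space "interaction \<pi> \<nu> h" by (rule prob_space_interaction)
  show "policy_value rew \<gamma> \<pi> \<nu> h \<le> 1"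
  proof (cases "integrable (interaction \<pi> \<nu> h) (total_return rew \<gamma>)")
    case True
    then show ?thesis unfolding policy_value_def by (intro integral_le_const) (auto simp: ub)
  next
    case False
    then show ?thesis by (simp add: policy_value_def not_integrable_integral_eq)
  qed
qed


subsection \<open>Augmented histories\<close>

definition return_levels :: "nat \<Rightarrow> real set" where
  "return_levels M = (\<lambda>k. real k / real M) ` {..<M}"

definition discretized_return :: "('r \<Rightarrow> real) \<Rightarrow> real \<Rightarrow> nat \<Rightarrow> nat \<Rightarrow> ('a, 'o, 'r) outcome \<Rightarrow> real" where
  "discretized_return rew \<gamma> H M \<omega> = of_int \<lfloor>real M * truncated_return rew \<gamma> H \<omega>\<rfloor> / real M"

text \<open>
  An augmented block carries an optional return symbol. In a well-formed phase-\<open>n\<close> augmented history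
  the symbol is present exactly at the (1-based) positions congruent to \<open>n\<close> modulo \<open>N\<close>; phases
  satisfy \<open>n < N\<close>.
\<close>

type_synonym ('a, 'o, 'r) aug_block = "'a \<times> real option \<times> 'o \<times> 'r"
type_synonym ('a, 'o, 'r) aug_history = "('a, 'o, 'r) aug_block list"

definition aug_action :: "('a, 'o, 'r) aug_block \<Rightarrow> 'a" where
  "aug_action b = fst b"

definition aug_symbol :: "('a, 'o, 'r) aug_block \<Rightarrow> real option" where
  "aug_symbol b = fst (snd b)"

definition strip_block :: "('a, 'o, 'r) aug_block \<Rightarrow> ('a, 'o, 'r) block" where
  "strip_block b = (fst b, snd (snd b))"

definition strip :: "('a, 'o, 'r) aug_history \<Rightarrow> ('a, 'o, 'r) history" where
  "strip g = map strip_block g"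

definition aug_histories :: "nat \<Rightarrow> nat \<Rightarrow> nat \<Rightarrow> ('a, 'o, 'r) aug_history set" where
  "aug_histories M N n =
     {g. \<forall>j<length g. if (j + 1) mod N = n then aug_symbol (g ! j) \<in> Some ` return_levels M
                      else aug_symbol (g ! j) = None}"

definition aug ::
  "('r \<Rightarrow> real) \<Rightarrow> real \<Rightarrow> nat \<Rightarrow> nat \<Rightarrow> nat \<Rightarrow> nat \<Rightarrow> ('a, 'o, 'r) outcome \<Rightarrow> nat \<Rightarrow> ('a, 'o, 'r) aug_block" where
  "aug rew \<gamma> H M N n \<omega> j =
     (fst (\<omega> j),
      if (j + 1) mod N = n then Some (discretized_return rew \<gamma> H M (\<lambda>k. \<omega> (j + k))) else None,
      snd (\<omega> j))"

text \<open>
  The augmentation of a finite history is the prefix of the augmentation of some outcome extending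
  it. Here the extension is \<open>(!) h\<close>, whose values beyond \<open>length h\<close> are irrelevant in the case
  \<open>n = (length h + 1) mod N\<close> used below, see \<open>aug_history_eq\<close>.
\<close>

definition aug_history ::
  "('r \<Rightarrow> real) \<Rightarrow> real \<Rightarrow> nat \<Rightarrow> nat \<Rightarrow> nat \<Rightarrow> nat \<Rightarrow> ('a, 'o, 'r) history \<Rightarrow> ('a, 'o, 'r) aug_history" where
  "aug_history rew \<gamma> H M N n h = map (aug rew \<gamma> H M N n ((!) h)) [0..<length h]"

lemma aug_history_eq:
  assumes "1 \<le> H" "H \<le> N" "n = (length h + 1) mod N" "map \<omega> [0..<length h] = h"
  shows "aug_history rew \<gamma> H M N n h = map (aug rew \<gamma> H M N n \<omega>) [0..<length h]"
proof -
  have w: "h ! j = \<omega> j" if "j < length h" for j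
    using assms(4) that by (metis add_0 diff_zero length_map length_upt nth_map nth_upt)
  have "aug rew \<gamma> H M N n ((!) h) j = aug rew \<gamma> H M N n \<omega> j" if j: "j < length h" for j
  proof (cases "(j + 1) mod N = n")
    case True
    with assms(3) have "(length h + 1) mod N = (j + 1) mod N" by simp
    then have "N dvd length h - j"
      using j mod_eq_dvd_iff_nat[of "j + 1" "length h + 1" N] by simp
    with j have "N \<le> length h - j" by (intro dvd_imp_le) auto
    with assms(2) j have "j + k < length h" if "k < H" for k using that by linarith
    then have "(\<Sum>k<H. \<gamma> ^ k * reward_at rew (\<lambda>k. h ! (j + k)) k) = (\<Sum>k<H. \<gamma> ^ k * reward_at rew (\<lambda>k. \<omega> (j + k)) k)"
      by (intro sum.cong) (auto simp: reward_at_def w)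
    then show ?thesis
      by (simp add: aug_def w j discretized_return_def truncated_return_def)
  qed (simp add: aug_def w j)
  then show ?thesis by (simp add: aug_history_def)
qed

lemma strip_aug_history: "strip (aug_history rew \<gamma> H M N n h) = h"
  by (rule nth_equalityI) (auto simp: strip_def strip_block_def aug_history_def aug_def)


subsection \<open>Return-predictors\<close>

text \<open>
  Only the values of a return-predictor at well-formed augmented histories \<open>g\<close> with
  \<open>(length g + 1) mod N = n\<close> are meaningful; the others are unconstrained.
\<close>

type_synonym ('a, 'o, 'r) predictor = "('a, 'o, 'r) aug_history \<Rightarrow> 'a \<Rightarrow> real pmf"

definition predictor_domain :: "nat \<Rightarrow> nat \<Rightarrow> nat \<Rightarrow> ('a, 'o, 'r) aug_history set" where
  "predictor_domain M N n = {g \<in> aug_histories M N n. (length g + 1) mod N = n}"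

definition return_predictor :: "nat \<Rightarrow> nat \<Rightarrow> nat \<Rightarrow> ('a, 'o, 'r) predictor \<Rightarrow> bool" where
  "return_predictor M N n \<phi> \<longleftrightarrow> (\<forall>g\<in>predictor_domain M N n. \<forall>a. set_pmf (\<phi> g a) \<subseteq> return_levels M)"

definition predictor_class ::
  "nat \<Rightarrow> nat \<Rightarrow> nat \<Rightarrow> ('a, 'o, 'r) predictor set \<Rightarrow> (('a, 'o, 'r) predictor \<Rightarrow> real) \<Rightarrow> bool" where
  "predictor_class M N n P w \<longleftrightarrow>
     countable P \<and> (\<forall>\<phi>\<in>P. return_predictor M N n \<phi> \<and> 0 < w \<phi>) \<and> (w has_sum 1) P"

definition symbols_likelihood :: "nat \<Rightarrow> nat \<Rightarrow> ('a, 'o, 'r) predictor \<Rightarrow> ('a, 'o, 'r) aug_history \<Rightarrow> real" where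
  "symbols_likelihood N n \<phi> g =
     (\<Prod>j | j < length g \<and> (j + 1) mod N = n. pmf (\<phi> (take j g) (aug_action (g ! j))) (the (aug_symbol (g ! j))))"

definition is_mixture ::
  "nat \<Rightarrow> nat \<Rightarrow> nat \<Rightarrow> ('a, 'o, 'r) predictor set \<Rightarrow> (('a, 'o, 'r) predictor \<Rightarrow> real) \<Rightarrow> ('a, 'o, 'r) predictor \<Rightarrow> bool" where
  "is_mixture M N n P w \<psi> \<longleftrightarrow> return_predictor M N n \<psi> \<and>
     (\<forall>g\<in>aug_histories M N n.
        symbols_likelihood N n \<psi> g = (\<Sum>\<^sub>\<infinity>\<phi>\<in>P. w \<phi> * symbols_likelihood N n \<phi> g))"

definition unified_predictor ::
  "('r \<Rightarrow> real) \<Rightarrow> real \<Rightarrow> nat \<Rightarrow> nat \<Rightarrow> nat \<Rightarrow> (nat \<Rightarrow> ('a, 'o, 'r) predictor) \<Rightarrow>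
   ('a, 'o, 'r) history \<Rightarrow> 'a \<Rightarrow> real pmf" where
  "unified_predictor rew \<gamma> H M N \<psi>s h a =
     (let n = (length h + 1) mod N in \<psi>s n (aug_history rew \<gamma> H M N n h) a)"


subsection \<open>The AIQI policy and the grain of truth\<close>

definition Q_estimate ::
  "nat \<Rightarrow> (('a, 'o, 'r) history \<Rightarrow> 'a \<Rightarrow> real pmf) \<Rightarrow> ('a, 'o, 'r) history \<Rightarrow> 'a \<Rightarrow> real" where
  "Q_estimate M \<psi> h a = (\<Sum>z\<in>return_levels M. z * pmf (\<psi> h a) z)"

text \<open>
  The distribution \<open>p\<close> implements the (possibly stochastic, history-dependent) tie-breaking, so
  this is a predicate rather than a function.
\<close>

definition is_AIQI_policy ::
  "nat \<Rightarrow> real \<Rightarrow> (('a::finite, 'o, 'r) history \<Rightarrow> 'a \<Rightarrow> real pmf) \<Rightarrow> ('a, 'o, 'r) policy \<Rightarrow> bool" where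
  "is_AIQI_policy M \<tau> \<psi> \<pi> \<longleftrightarrow>
     (\<forall>h. \<exists>p. set_pmf p \<subseteq> {a. \<forall>b. Q_estimate M \<psi> h b \<le> Q_estimate M \<psi> h a} \<and>
        (\<forall>a. pmf (\<pi> h) a = (1 - \<tau>) * pmf p a + \<tau> / CARD('a)))"

definition grain_of_truth ::
  "('r \<Rightarrow> real) \<Rightarrow> real \<Rightarrow> nat \<Rightarrow> nat \<Rightarrow> nat \<Rightarrow> (nat \<Rightarrow> ('a, 'o, 'r) predictor set) \<Rightarrow>
   ('a, 'o, 'r) policy \<Rightarrow> ('a, 'o, 'r) environment \<Rightarrow> bool" where
  "grain_of_truth rew \<gamma> H M N P \<pi> \<nu> \<longleftrightarrow>
     (\<forall>n<N. \<exists>\<phi>\<in>P n. \<forall>g\<in>predictor_domain M N n. \<forall>a. \<forall>z\<in>return_levels M.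
        pmf (\<phi> g a) z =
          measure (interaction_act \<pi> \<nu> (strip g) a) {\<omega>. discretized_return rew \<gamma> H M \<omega> = z})"

end

theory Submission
  imports Defs
begin

text \<open>Predictions are known to be accurate only in expectation and only along histories that
  \<open>\<pi>\<close> itself produces, whereas optimality compares with arbitrary policies. The
  comparison runs over \<open>K\<close> steps with \<open>K\<close> fixed before time grows: the
  price per step, the discount times the number of actions over \<open>\<tau>\<close>, may exceed 1,
  so nothing uniform in \<open>K\<close> can be hoped for. Summability over time survives any factor
  that depends on \<open>K\<close> alone, and discounting absorbs what lies beyond \<open>K\<close>
  steps.

  The squared Hellinger distance appears as the mean of 1 - sqrt (p / q) under the true
  probabilities q. Unlike a logarithm this stays finite where p = 0, and its sum along a path is
  bounded pathwise. Integrating that bound term by term needs only linearity of expectation, no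
  martingale.

  Errors of expected returns are of the order of the square root of this distance, and expectations
  of such roots need not be summable. They are therefore traded for the distance itself plus a small
  constant, which is why a slack \<open>\<theta>\<close> runs through the second half.\<close>

text \<open>
  Along the interaction, the mixture of phase \<open>n\<close> dominates the true return-predictor up to its prior
  weight. Taking logarithms, the expected squared Hellinger distances between the predicted and the
  true return distributions at the actions taken are summable over time, and since every action is
  explored with probability at least \<open>\<tau> / |A|\<close>, so are the distances summed over all actions.
  Hence the expectation of any fixed finite lookahead of these distances is summable as well, and the
  lookahead tends to 0 almost surely. Where the distances are small, \<open>\<pi>\<close> is nearly greedy for its own
  action values, so a telescoping argument over finitely many steps bounds the advantage of any
  other policy. Any competitor's finite-horizon law is absolutely continuous with respect to that of
  \<open>\<pi>\<close>, with density at most \<open>(|A| / \<tau>) ^ K\<close> over \<open>K\<close> steps.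
\<close>

subsection \<open>The Markov property of the interaction\<close>

abbreviation outcomes :: "('a::finite, 'o::finite, 'r::finite) outcome measure" where
  "outcomes \<equiv> PiM UNIV (\<lambda>_. count_space UNIV)"

abbreviation cylinder :: "('a, 'o, 'r) history \<Rightarrow> ('a, 'o, 'r) outcome set" where
  "cylinder g \<equiv> {\<omega>. map \<omega> [0..<length g] = g}"

lemma sets_interaction [simp, measurable_cong]:
  fixes \<pi> :: "('a::finite, 'o::finite, 'r::finite) policy"
  shows "sets (interaction \<pi> \<nu> h) = sets outcomes"
proof -
  interpret IT: Ionescu_Tulcea "\<lambda>i \<omega>. measure_pmf (block_pmf \<pi> \<nu> (h @ map \<omega> [0..<i]))" "\<lambda>_. count_space UNIV"
    by (rule Ionescu_Tulcea_interaction)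
  show ?thesis unfolding interaction_def by (rule IT.PF.sets_lim)
qed

lemma space_interaction [simp]:
  fixes \<pi> :: "('a::finite, 'o::finite, 'r::finite) policy"
  shows "space (interaction \<pi> \<nu> h) = UNIV"
  using sets_eq_imp_space_eq[OF sets_interaction[of \<pi> \<nu> h]] by (simp add: space_PiM)

lemma map_upt_eq_iff: "map \<omega> [0..<length g] = g \<longleftrightarrow> (\<forall>i<length g. \<omega> i = g ! i)"
  by (subst list_eq_iff_nth_eq) simp

lemma map_case_nat: "map (case_nat b \<omega>) [0..<Suc k] = b # map \<omega> [0..<k]"
  unfolding upt_conv_Cons[OF zero_less_Suc] by (simp flip: map_Suc_upt del: upt_Suc)

lemma sets_cylinder [measurable]: "cylinder (g :: ('a::finite, 'o::finite, 'r::finite) history) \<in> sets outcomes"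
proof -
  have "{\<omega> \<in> space outcomes. \<forall>i<length g. \<omega> i = g ! i} \<in> sets outcomes"
    by measurable
  then show ?thesis by (simp add: map_upt_eq_iff space_PiM)
qed

lemma finite_lists_length_eq_UNIV: "finite {g :: 'b::finite list. length g = n}"
  using finite_lists_length_eq[of "UNIV :: 'b set" n] by simp

text \<open>An event about coordinate \<open>i\<close> is the union of the cylinders of length
  \<open>Suc i\<close> whose last block satisfies it. There are only finitely many of them, because
  the blocks form a finite type.\<close>

lemma sets_outcomes_cylinder:
  "sets (outcomes :: ('a::finite, 'o::finite, 'r::finite) outcome measure) =
    sigma_sets UNIV (insert {} (range cylinder))" (is "sets ?M = sigma_sets UNIV ?G")
proof
  have *: "?G \<subseteq> sets ?M" using sets_cylinder by blast
  show "sigma_sets UNIV ?G \<subseteq> sets ?M"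
    using sets.sigma_sets_subset[OF *] by (simp add: space_PiM)
  interpret sigma_algebra UNIV "sigma_sets UNIV ?G"
    by (rule sigma_algebra_sigma_sets) simp
  have "{\<omega> :: ('a, 'o, 'r) outcome. \<omega> i \<in> A} \<in> sigma_sets UNIV ?G" for i A
  proof -
    have "{\<omega>. \<omega> i \<in> A} = (\<Union>g\<in>{g. length g = Suc i \<and> g ! i \<in> A}. cylinder g)" (is "?L = ?R")
    proof
      show "?L \<subseteq> ?R"
      proof
        fix \<omega> assume "\<omega> \<in> ?L"
        then show "\<omega> \<in> ?R"
          by (intro UN_I[of "map \<omega> [0..<Suc i]"]) (auto simp del: upt_Suc)
      qed
      show "?R \<subseteq> ?L" by (auto simp: map_upt_eq_iff simp del: upt_Suc)
    qed
    also have "\<dots> \<in> sigma_sets UNIV ?G"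
    proof (rule finite_UN)
      show "finite {g :: ('a, 'o, 'r) history. length g = Suc i \<and> g ! i \<in> A}"
        by (rule finite_subset[OF _ finite_lists_length_eq_UNIV[of "Suc i"]]) auto
    qed (blast intro: sigma_sets.Basic)
    finally show ?thesis .
  qed
  then show "sets ?M \<subseteq> sigma_sets UNIV ?G"
    by (simp add: sets_PiM_single) (intro sigma_sets_subset, auto)
qed

text \<open>Two cylinders are nested or disjoint, so together with the empty set they form an
  intersection-stable generator, and the uniqueness theorem for measures applies.\<close>

lemma interaction_eqI:
  fixes \<pi> :: "('a::finite, 'o::finite, 'r::finite) policy"
  assumes "sets N = sets outcomes"
    and "\<And>g. emeasure (interaction \<pi> \<nu> h) (cylinder g) = emeasure N (cylinder g)"
  shows "interaction \<pi> \<nu> h = N"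
proof (rule measure_eqI_generator_eq[where \<Omega> = UNIV and E = "insert {} (range cylinder)" and A = "\<lambda>_. cylinder []"])
  have *: "cylinder g \<inter> cylinder g' = (if take (length g') g = g' then cylinder g else {})"
    if "length g' \<le> length g" for g g' :: "('a, 'o, 'r) history"
  proof -
    have "take (length g') g = g' \<longleftrightarrow> (\<forall>i<length g'. g ! i = g' ! i)"
      using that by (subst list_eq_iff_nth_eq) auto
    with that show ?thesis by (auto simp: map_upt_eq_iff)
  qed
  have "cylinder g \<inter> cylinder g' \<in> insert {} (range cylinder)" for g g' :: "('a, 'o, 'r) history"
  proof (cases "length g' \<le> length g")
    case True
    show ?thesis unfolding *[OF True] by auto
  next
    case False
    then have le: "length g \<le> length g'" by simp
    show ?thesis unfolding Int_commute[of "cylinder g"] *[OF le] by auto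
  qed
  then show "Int_stable (insert {} (range (cylinder :: ('a, 'o, 'r) history \<Rightarrow> _)))"
    unfolding Int_stable_def by blast
  show "emeasure (interaction \<pi> \<nu> h) (cylinder []) \<noteq> \<infinity>"
    unfolding emeasure_interaction_cylinder by simp
  show "sets (interaction \<pi> \<nu> h) = sigma_sets UNIV (insert {} (range cylinder))"
    unfolding sets_interaction by (rule sets_outcomes_cylinder)
  show "sets N = sigma_sets UNIV (insert {} (range cylinder))"
    unfolding assms(1) by (rule sets_outcomes_cylinder)
  show "range (\<lambda>_. cylinder []) \<subseteq> insert {} (range (cylinder :: ('a, 'o, 'r) history \<Rightarrow> _))"
    by blast
qed (use assms(2) in auto)

lemma measurable_interaction_block:
  fixes \<pi> :: "('a::finite, 'o::finite, 'r::finite) policy"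
  shows "(\<lambda>b. distr (interaction \<pi> \<nu> (h @ [b])) outcomes (case_nat b))
    \<in> measurable (measure_pmf p) (subprob_algebra outcomes)"
proof -
  have "distr (interaction \<pi> \<nu> (h @ [b])) outcomes (case_nat b) \<in> space (subprob_algebra outcomes)" for b
    using prob_space.prob_space_distr[OF prob_space_interaction[of \<pi> \<nu> "h @ [b]"], of "case_nat b" outcomes]
    by (auto simp: space_subprob_algebra intro: prob_space_imp_subprob_space)
  then show ?thesis
    by (subst measurable_cong_sets[OF sets_measure_pmf_count_space refl]) auto
qed

text \<open>First-step decomposition. On a cylinder, prepending a block forces the first block of
  the cylinder, and what is left is the product formula without its first factor.\<close>

lemma interaction_bind:
  fixes \<pi> :: "('a::finite, 'o::finite, 'r::finite) policy"
  shows "interaction \<pi> \<nu> h =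
    measure_pmf (block_pmf \<pi> \<nu> h) \<bind> (\<lambda>b. distr (interaction \<pi> \<nu> (h @ [b])) outcomes (case_nat b))"
    (is "_ = ?N")
proof (rule interaction_eqI)
  show "sets ?N = sets outcomes"
    by (intro sets_bind) auto
  fix g :: "('a, 'o, 'r) history"
  have "emeasure ?N (cylinder g) =
    (\<integral>\<^sup>+b. emeasure (distr (interaction \<pi> \<nu> (h @ [b])) outcomes (case_nat b)) (cylinder g) \<partial>block_pmf \<pi> \<nu> h)"
    by (intro emeasure_bind[OF _ measurable_interaction_block]) auto
  also have "\<dots> = (\<integral>\<^sup>+b. emeasure (interaction \<pi> \<nu> (h @ [b])) (case_nat b -` cylinder g) \<partial>block_pmf \<pi> \<nu> h)"
    by (simp add: emeasure_distr)
  also have "\<dots> = emeasure (interaction \<pi> \<nu> h) (cylinder g)"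
  proof (cases g)
    case Nil
    then show ?thesis
      using measure_pmf.emeasure_space_1
      by (simp add: prob_space.emeasure_space_1[OF prob_space_interaction, simplified])
  next
    case (Cons b0 g')
    have "case_nat b -` cylinder g = (if b = b0 then cylinder g' else {})" for b
      by (auto simp: Cons map_case_nat simp del: upt_Suc)
    then have "(\<integral>\<^sup>+b. emeasure (interaction \<pi> \<nu> (h @ [b])) (case_nat b -` cylinder g) \<partial>block_pmf \<pi> \<nu> h) =
      (\<integral>\<^sup>+b. emeasure (interaction \<pi> \<nu> (h @ [b0])) (cylinder g') * indicator {b0} b \<partial>block_pmf \<pi> \<nu> h)"
      by (intro nn_integral_cong) (auto simp: indicator_def)
    also have "\<dots> = emeasure (interaction \<pi> \<nu> (h @ [b0])) (cylinder g') * ennreal (pmf (block_pmf \<pi> \<nu> h) b0)"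
      by (subst nn_integral_cmult_indicator) (auto simp: emeasure_pmf_single)
    also have "\<dots> = emeasure (interaction \<pi> \<nu> h) (cylinder g)"
      unfolding emeasure_interaction_cylinder
      by (cases b0) (simp add: Cons pmf_block_pmf prod.lessThan_Suc_shift ennreal_mult' ennreal_mult'' prod_nonneg mult_ac del: prod.lessThan_Suc)
    finally show ?thesis .
  qed
  finally show "emeasure (interaction \<pi> \<nu> h) (cylinder g) = emeasure ?N (cylinder g)" ..
qed

lemma integrable_interaction:
  fixes \<pi> :: "('a::finite, 'o::finite, 'r::finite) policy" and f :: "_ \<Rightarrow> real"
  assumes [measurable]: "f \<in> borel_measurable outcomes" and "\<And>\<omega>. \<bar>f \<omega>\<bar> \<le> B"
  shows "integrable (interaction \<pi> \<nu> h) f"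
proof -
  interpret prob_space "interaction \<pi> \<nu> h" by (rule prob_space_interaction)
  show ?thesis using assms(2) by (intro integrable_const_bound[of _ B]) auto
qed

lemma abs_integral_interaction_le:
  fixes \<pi> :: "('a::finite, 'o::finite, 'r::finite) policy" and f :: "_ \<Rightarrow> real"
  assumes [measurable]: "f \<in> borel_measurable outcomes" and B: "\<And>\<omega>. \<bar>f \<omega>\<bar> \<le> B"
  shows "\<bar>\<integral>\<omega>. f \<omega> \<partial>interaction \<pi> \<nu> h\<bar> \<le> B"
proof -
  interpret prob_space "interaction \<pi> \<nu> h" by (rule prob_space_interaction)
  have f: "integrable (interaction \<pi> \<nu> h) f" by (rule integrable_interaction[OF assms])
  have "f \<omega> \<le> B" "- B \<le> f \<omega>" for \<omega> using B[of \<omega>] by auto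
  then show ?thesis
    using integral_le_const[OF f, of B] integral_ge_const[OF f, of "- B"] by auto
qed

lemma integral_interaction_block:
  fixes \<pi> :: "('a::finite, 'o::finite, 'r::finite) policy" and f :: "_ \<Rightarrow> real"
  assumes f [measurable]: "f \<in> borel_measurable outcomes" and B: "\<And>\<omega>. \<bar>f \<omega>\<bar> \<le> B"
  shows "(\<integral>\<omega>. f \<omega> \<partial>interaction \<pi> \<nu> h) =
    (\<integral>b. (\<integral>\<omega>. f (case_nat b \<omega>) \<partial>interaction \<pi> \<nu> (h @ [b])) \<partial>block_pmf \<pi> \<nu> h)"
proof -
  have "prob_space (distr (interaction \<pi> \<nu> (h @ [b])) outcomes (case_nat b))" for b
    by (rule prob_space.prob_space_distr[OF prob_space_interaction]) measurable
  then have le: "emeasure (distr (interaction \<pi> \<nu> (h @ [b])) outcomes (case_nat b)) UNIV \<le> 1" for b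
    by (rule prob_space.emeasure_le_1)
  have "(\<integral>\<omega>. f \<omega> \<partial>interaction \<pi> \<nu> h) =
      (\<integral>b. (\<integral>\<omega>. f \<omega> \<partial>distr (interaction \<pi> \<nu> (h @ [b])) outcomes (case_nat b)) \<partial>block_pmf \<pi> \<nu> h)"
    unfolding interaction_bind[of \<pi> \<nu> h]
    by (rule integral_bind[OF f _ measurable_interaction_block, where B = B and B' = 1])
      (auto simp: B le space_PiM
        intro: measure_pmf.finite_measure_axioms)
  then show ?thesis by (simp add: integral_distr)
qed

lemma integral_interaction_act:
  fixes \<pi> :: "('a::finite, 'o::finite, 'r::finite) policy" and f :: "_ \<Rightarrow> real"
  assumes f [measurable]: "f \<in> borel_measurable outcomes" and B: "\<And>\<omega>. \<bar>f \<omega>\<bar> \<le> B"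
  shows "(\<integral>\<omega>. f \<omega> \<partial>interaction_act \<pi> \<nu> h a) =
    (\<integral>e. (\<integral>\<omega>. f (case_nat (a, e) \<omega>) \<partial>interaction \<pi> \<nu> (h @ [(a, e)])) \<partial>\<nu> h a)"
proof -
  have "interaction (\<pi>(h := return_pmf a)) \<nu> (h @ [b]) = interaction \<pi> \<nu> (h @ [b])" for b
    by (simp add: interaction_def block_pmf_def)
  then show ?thesis
    unfolding interaction_act_def by (subst integral_interaction_block[OF f B]) (simp add: block_pmf_def bind_return_pmf)
qed

lemma integral_block_pmf:
  fixes \<pi> :: "('a::finite, 'o::finite, 'r::finite) policy" and F :: "_ \<Rightarrow> real"
  shows "(\<integral>b. F b \<partial>block_pmf \<pi> \<nu> h) = (\<integral>a. (\<integral>e. F (a, e) \<partial>\<nu> h a) \<partial>\<pi> h)"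
proof -
  have "(\<integral>b. F b \<partial>block_pmf \<pi> \<nu> h) = (\<Sum>b\<in>UNIV. F b * pmf (block_pmf \<pi> \<nu> h) b)"
    by (rule integral_measure_pmf_real) auto
  also have "\<dots> = (\<Sum>a\<in>UNIV. \<Sum>e\<in>UNIV. F (a, e) * (pmf (\<pi> h) a * pmf (\<nu> h a) e))"
    by (simp add: sum.cartesian_product pmf_block_pmf split_beta' flip: UNIV_Times_UNIV)
      (metis (no_types, lifting) pmf_block_pmf prod.collapse)
  also have "\<dots> = (\<Sum>a\<in>UNIV. (\<Sum>e\<in>UNIV. F (a, e) * pmf (\<nu> h a) e) * pmf (\<pi> h) a)"
    by (simp add: sum_distrib_right sum_distrib_left mult_ac)
  also have "\<dots> = (\<Sum>a\<in>UNIV. (\<integral>e. F (a, e) \<partial>\<nu> h a) * pmf (\<pi> h) a)"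
    by (intro sum.cong refl arg_cong2[where f = "(*)"] integral_measure_pmf_real[symmetric]) auto
  also have "\<dots> = (\<integral>a. (\<integral>e. F (a, e) \<partial>\<nu> h a) \<partial>\<pi> h)"
    by (rule integral_measure_pmf_real[symmetric]) auto
  finally show ?thesis .
qed

text \<open>Disintegration over the first action. The action is a separate argument of
  \<open>f\<close>, so that on each branch only the remaining dependence on the outcome has to be
  integrated.\<close>

lemma integral_interaction_split:
  fixes \<pi> :: "('a::finite, 'o::finite, 'r::finite) policy" and f :: "'a \<Rightarrow> _ \<Rightarrow> real"
  assumes f [measurable]: "\<And>a. f a \<in> borel_measurable outcomes" and B: "\<And>a \<omega>. \<bar>f a \<omega>\<bar> \<le> B"
  shows "(\<integral>\<omega>. f (fst (\<omega> 0)) \<omega> \<partial>interaction \<pi> \<nu> h) = (\<integral>a. (\<integral>\<omega>. f a \<omega> \<partial>interaction_act \<pi> \<nu> h a) \<partial>\<pi> h)"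
proof -
  have [measurable]: "(\<lambda>\<omega>. f (fst (\<omega> 0)) \<omega>) \<in> borel_measurable outcomes"
    by (rule measurable_compose_countable[OF f measurable_compose[where g = fst, OF measurable_component_singleton]]) auto
  have "(\<integral>\<omega>. f (fst (\<omega> 0)) \<omega> \<partial>interaction \<pi> \<nu> h) = 
     (\<integral>b. (\<integral>\<omega>. f (fst b) (case_nat b \<omega>) \<partial>interaction \<pi> \<nu> (h @ [b])) \<partial>block_pmf \<pi> \<nu> h)"
    by (subst integral_interaction_block) (auto intro: B)
  also have "\<dots> = (\<integral>a. (\<integral>e. (\<integral>\<omega>. f a (case_nat (a, e) \<omega>) \<partial>interaction \<pi> \<nu> (h @ [(a, e)])) \<partial>\<nu> h a) \<partial>\<pi> h)"
    unfolding integral_block_pmf by simp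
  also have "\<dots> = (\<integral>a. (\<integral>\<omega>. f a \<omega> \<partial>interaction_act \<pi> \<nu> h a) \<partial>\<pi> h)"
    by (subst integral_interaction_act[OF f B]) simp
  finally show ?thesis .
qed

lemma measurable_prefix [measurable]:
  "(\<lambda>\<omega> :: ('a::finite, 'o::finite, 'r::finite) outcome. map \<omega> [0..<k]) \<in> measurable outcomes (count_space UNIV)"
  unfolding measurable_count_space_eq_countable[OF countableI_type]
proof (intro conjI ballI)
  fix g :: "('a, 'o, 'r) history"
  show "(\<lambda>\<omega>. map \<omega> [0..<k]) -` {g} \<inter> space outcomes \<in> sets outcomes"
  proof (cases "length g = k")
    case True
    then have "(\<lambda>\<omega>. map \<omega> [0..<k]) -` {g} \<inter> space outcomes = cylinder g"
      by (auto simp: space_PiM)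
    then show ?thesis by (simp only: sets_cylinder)
  next
    case False
    then have "(\<lambda>\<omega>. map \<omega> [0..<k]) -` {g} \<inter> space outcomes = {}" by auto
    then show ?thesis by (simp only: sets.empty_sets)
  qed
qed auto

lemma measurable_prefix_fun [measurable]:
  "(\<lambda>\<omega> :: ('a::finite, 'o::finite, 'r::finite) outcome. F (map \<omega> [0..<k])) \<in> borel_measurable outcomes"
  by (rule measurable_compose[OF measurable_prefix]) simp

lemma measurable_prefix_suffix:
  fixes f :: "('a::finite, 'o::finite, 'r::finite) history \<Rightarrow> _ \<Rightarrow> real"
  assumes f: "\<And>g. f g \<in> borel_measurable outcomes"
  shows "(\<lambda>\<omega>. f (map \<omega> [0..<k]) (\<lambda>i. \<omega> (k + i))) \<in> borel_measurable outcomes"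
proof (rule measurable_compose_countable[OF _ measurable_prefix])
  show "(\<lambda>\<omega>. f g (\<lambda>i. \<omega> (k + i))) \<in> borel_measurable outcomes" for g
    by (rule measurable_compose[OF measurable_abs_UNIV f]) measurable
qed

text \<open>Markov property at a fixed time. The induction peels off the first block and absorbs it
  both into the starting history and into the first argument of \<open>f\<close>, so both have to be
  generalised.\<close>

lemma integral_interaction_Markov_bounded:
  fixes \<pi> :: "('a::finite, 'o::finite, 'r::finite) policy" and f :: "_ \<Rightarrow> _ \<Rightarrow> real"
  assumes f [measurable]: "\<And>g. f g \<in> borel_measurable outcomes" and B: "\<And>g \<omega>. \<bar>f g \<omega>\<bar> \<le> B"
  shows "(\<integral>\<omega>. f (map \<omega> [0..<k]) (\<lambda>i. \<omega> (k + i)) \<partial>interaction \<pi> \<nu> h) =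
    (\<integral>\<omega>. (\<integral>\<omega>'. f (map \<omega> [0..<k]) \<omega>' \<partial>interaction \<pi> \<nu> (h @ map \<omega> [0..<k])) \<partial>interaction \<pi> \<nu> h)"
  using f B
proof (induction k arbitrary: h f)
  case 0
  show ?case by (simp add: prob_space.prob_space[OF prob_space_interaction, simplified])
next
  case (Suc k)
  note [measurable] = Suc.prems(1)
  have bdd: "\<bar>\<integral>\<omega>'. f g \<omega>' \<partial>interaction \<pi> \<nu> h\<bar> \<le> B" for g h
    by (rule abs_integral_interaction_le) (use Suc.prems in auto)
  have "(\<integral>\<omega>. f (map \<omega> [0..<Suc k]) (\<lambda>i. \<omega> (Suc k + i)) \<partial>interaction \<pi> \<nu> h) =
    (\<integral>b. (\<integral>\<omega>. f (b # map \<omega> [0..<k]) (\<lambda>i. \<omega> (k + i)) \<partial>interaction \<pi> \<nu> (h @ [b])) \<partial>block_pmf \<pi> \<nu> h)"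
    by (subst integral_interaction_block[OF measurable_prefix_suffix[OF Suc.prems(1)] Suc.prems(2)])
      (simp add: map_case_nat del: upt_Suc)
  also have "\<dots> = (\<integral>b. (\<integral>\<omega>. (\<integral>\<omega>'. f (b # map \<omega> [0..<k]) \<omega>' \<partial>interaction \<pi> \<nu> ((h @ [b]) @ map \<omega> [0..<k]))
      \<partial>interaction \<pi> \<nu> (h @ [b])) \<partial>block_pmf \<pi> \<nu> h)"
    by (intro Bochner_Integration.integral_cong refl Suc.IH) (use Suc.prems in auto)
  also have "\<dots> = (\<integral>\<omega>. (\<integral>\<omega>'. f (map \<omega> [0..<Suc k]) \<omega>' \<partial>interaction \<pi> \<nu> (h @ map \<omega> [0..<Suc k])) \<partial>interaction \<pi> \<nu> h)"
    by (subst (2) integral_interaction_block[OF measurable_prefix_fun bdd]) (simp add: map_case_nat del: upt_Suc)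
  finally show ?case .
qed

lemma prefix_bounded:
  fixes f :: "('a::finite, 'o::finite, 'r::finite) history \<Rightarrow> 'b \<Rightarrow> real"
  assumes "\<And>g x. \<bar>f g x\<bar> \<le> B g"
  shows "\<bar>f (map \<omega> [0..<k]) x\<bar> \<le> (\<Sum>g | length g = k. B g)"
proof -
  have "0 \<le> B g" for g using assms[of g undefined] by linarith
  then have "B (map \<omega> [0..<k]) \<le> (\<Sum>g | length g = k. B g)"
    by (intro member_le_sum) (auto simp: finite_lists_length_eq_UNIV)
  with assms[of "map \<omega> [0..<k]" x] show ?thesis by linarith
qed

lemma integrable_prefix_suffix:
  fixes \<pi> :: "('a::finite, 'o::finite, 'r::finite) policy" and f :: "_ \<Rightarrow> _ \<Rightarrow> real"
  assumes f: "\<And>g. f g \<in> borel_measurable outcomes" and B: "\<And>g \<omega>. \<bar>f g \<omega>\<bar> \<le> B g"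
  shows "integrable (interaction \<pi> \<nu> h) (\<lambda>\<omega>. f (map \<omega> [0..<k]) (\<lambda>i. \<omega> (k + i)))"
  by (rule integrable_interaction[OF measurable_prefix_suffix[of f, OF f] prefix_bounded[of f, OF B]])

lemma integrable_prefix:
  fixes \<pi> :: "('a::finite, 'o::finite, 'r::finite) policy" and F :: "_ \<Rightarrow> real"
  shows "integrable (interaction \<pi> \<nu> h) (\<lambda>\<omega>. F (map \<omega> [0..<k]))"
  by (rule integrable_prefix_suffix[of "\<lambda>g _. F g" "\<lambda>g. \<bar>F g\<bar>"]) auto

lemma integral_interaction_Markov:
  fixes \<pi> :: "('a::finite, 'o::finite, 'r::finite) policy" and f :: "_ \<Rightarrow> _ \<Rightarrow> real"
  assumes f: "\<And>g. f g \<in> borel_measurable outcomes" and B: "\<And>g \<omega>. \<bar>f g \<omega>\<bar> \<le> B g"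
  shows "(\<integral>\<omega>. f (map \<omega> [0..<k]) (\<lambda>i. \<omega> (k + i)) \<partial>interaction \<pi> \<nu> h) =
    (\<integral>\<omega>. (\<integral>\<omega>'. f (map \<omega> [0..<k]) \<omega>' \<partial>interaction \<pi> \<nu> (h @ map \<omega> [0..<k])) \<partial>interaction \<pi> \<nu> h)"
proof -
  \<comment> \<open>Only prefixes of length \<open>k\<close> occur, and there are finitely many.
    Setting \<open>f\<close> to 0 at all other prefixes turns the bounds \<open>B g\<close> into a
    single one.\<close>
  define f' where "f' g = (if length g = k then f g else (\<lambda>_. 0))" for g
  have 1: "f' g \<in> borel_measurable outcomes" for g
    using f by (simp add: f'_def)
  have "0 \<le> B g" for g using B[of g undefined] by linarith
  then have 2: "\<bar>f' g \<omega>\<bar> \<le> (\<Sum>g | length g = k. B g)" for g \<omega>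
  proof (cases "length g = k")
    case True
    then have "B g \<le> (\<Sum>g | length g = k. B g)"
      using \<open>\<And>g. 0 \<le> B g\<close> by (intro member_le_sum) (auto simp: finite_lists_length_eq_UNIV)
    with True B[of g \<omega>] show ?thesis by (simp add: f'_def)
  qed (auto simp: f'_def intro: sum_nonneg)
  from integral_interaction_Markov_bounded[of f', OF 1 2, where k = k] show ?thesis
    by (simp add: f'_def)
qed

subsection \<open>Returns\<close>

lemma prob_space_interaction_act:
  fixes \<pi> :: "('a::finite, 'o::finite, 'r::finite) policy"
  shows "prob_space (interaction_act \<pi> \<nu> h a)"
  unfolding interaction_act_def by (rule prob_space_interaction)

lemma sets_interaction_act [simp, measurable_cong]:
  fixes \<pi> :: "('a::finite, 'o::finite, 'r::finite) policy"
  shows "sets (interaction_act \<pi> \<nu> h a) = sets outcomes"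
  unfolding interaction_act_def by (rule sets_interaction)

lemma space_interaction_act [simp]:
  fixes \<pi> :: "('a::finite, 'o::finite, 'r::finite) policy"
  shows "space (interaction_act \<pi> \<nu> h a) = UNIV"
  unfolding interaction_act_def by simp

lemma measurable_reward_at [measurable]:
  "(\<lambda>\<omega> :: ('a::finite, 'o::finite, 'r::finite) outcome. reward_at rew \<omega> k) \<in> borel_measurable outcomes"
  unfolding reward_at_def
  by (rule measurable_compose[where g = "\<lambda>b. rew (snd (snd b))", OF measurable_component_singleton]) auto

lemma measurable_discretized_return:
  "(\<lambda>\<omega> :: ('a::finite, 'o::finite, 'r::finite) outcome. discretized_return rew \<gamma> H M \<omega>)
    \<in> measurable outcomes (count_space UNIV)"
proof -
  have "(\<lambda>\<omega> :: ('a, 'o, 'r) outcome. \<lfloor>real M * truncated_return rew \<gamma> H \<omega>\<rfloor>) \<in> measurable outcomes (count_space UNIV)"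
    unfolding truncated_return_def by measurable
  from measurable_compose[OF this, of "\<lambda>i. of_int i / real M"] show ?thesis
    unfolding discretized_return_def by simp
qed

lemma measurable_discretized_return_fun [measurable]:
  "(\<lambda>\<omega> :: ('a::finite, 'o::finite, 'r::finite) outcome. F (discretized_return rew \<gamma> H M \<omega>)) \<in> borel_measurable outcomes"
  by (rule measurable_compose[OF measurable_discretized_return]) simp

lemma measurable_total_return [measurable]:
  "(\<lambda>\<omega> :: ('a::finite, 'o::finite, 'r::finite) outcome. total_return rew \<gamma> \<omega>) \<in> borel_measurable outcomes"
  unfolding total_return_def by measurable

lemma finite_return_levels [simp]: "finite (return_levels M)"
  by (simp add: return_levels_def)

lemma abs_return_level_le: "z \<in> return_levels M \<Longrightarrow> \<bar>z\<bar> \<le> 1"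
  by (auto simp: return_levels_def divide_simps)

section \<open>Bounds for truncated, total and discretized returns\<close>

locale discounted_rewards =
  fixes rew :: "'r::finite \<Rightarrow> real" and \<gamma> :: real
  assumes range_rew: "range rew \<subseteq> {0..1}" and \<gamma>_pos: "0 < \<gamma>" and \<gamma>_less_1: "\<gamma> < 1"
begin

lemma rew_bounds: "0 \<le> rew r" "rew r \<le> 1"
  using range_rew by (auto simp: image_subset_iff)

lemma reward_at_bounds: "0 \<le> reward_at rew \<omega> k" "reward_at rew \<omega> k \<le> 1"
  by (simp_all add: reward_at_def rew_bounds)

lemma summable_discounted: "summable (\<lambda>k. \<gamma> ^ k * reward_at rew \<omega> k)"
  using \<gamma>_pos \<gamma>_less_1 reward_at_bounds[of \<omega>]
  by (intro summable_comparison_test'[OF summable_geometric[of \<gamma>], of 0]) (auto simp: mult_left_le)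

lemma truncated_return_bounds: "0 \<le> truncated_return rew \<gamma> H \<omega>" "truncated_return rew \<gamma> H \<omega> \<le> 1 - \<gamma> ^ H"
proof -
  show "0 \<le> truncated_return rew \<gamma> H \<omega>"
    using \<gamma>_pos \<gamma>_less_1 reward_at_bounds by (auto simp: truncated_return_def intro!: mult_nonneg_nonneg sum_nonneg)
  have "(\<Sum>k<H. \<gamma> ^ k * reward_at rew \<omega> k) \<le> (\<Sum>k<H. \<gamma> ^ k)"
    using \<gamma>_pos reward_at_bounds by (intro sum_mono) (auto simp: mult_left_le)
  also have "\<dots> = (1 - \<gamma> ^ H) / (1 - \<gamma>)"
    using \<gamma>_less_1 by (simp add: sum_gp_strict)
  finally show "truncated_return rew \<gamma> H \<omega> \<le> 1 - \<gamma> ^ H"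
    using \<gamma>_less_1 by (simp add: truncated_return_def field_simps)
qed

lemma total_return_eq_truncated:
  "total_return rew \<gamma> \<omega> = truncated_return rew \<gamma> H \<omega> + \<gamma> ^ H * total_return rew \<gamma> (\<lambda>i. \<omega> (H + i))"
  unfolding total_return_def truncated_return_def
  using suminf_split_initial_segment[OF summable_discounted[of \<omega>], of H]
    suminf_mult[OF summable_discounted[of "\<lambda>i. \<omega> (H + i)"], of "\<gamma> ^ H"]
  by (simp add: reward_at_def power_add algebra_simps)

lemma total_return_bounds: "0 \<le> total_return rew \<gamma> \<omega>" "total_return rew \<gamma> \<omega> \<le> 1"
proof -
  show "0 \<le> total_return rew \<gamma> \<omega>"
    using \<gamma>_pos \<gamma>_less_1 reward_at_bounds
    by (auto simp: total_return_def intro!: mult_nonneg_nonneg suminf_nonneg summable_discounted)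
  have "(\<Sum>k. \<gamma> ^ k * reward_at rew \<omega> k) \<le> (\<Sum>k. \<gamma> ^ k)"
    using \<gamma>_pos \<gamma>_less_1 reward_at_bounds
    by (intro suminf_le summable_discounted summable_geometric) (auto simp: mult_left_le)
  then show "total_return rew \<gamma> \<omega> \<le> 1"
    using \<gamma>_pos \<gamma>_less_1 by (simp add: total_return_def suminf_geometric field_simps)
qed

lemma abs_total_return_le: "\<bar>total_return rew \<gamma> \<omega>\<bar> \<le> 1"
  using total_return_bounds[of \<omega>] by simp

text \<open>Both approximations err downwards: cutting off after \<open>H\<close> steps loses at
  most \<open>\<gamma> ^ H\<close>, rounding down loses at most \<open>1 / M\<close>.\<close>

lemma discretized_return_bounds:
  assumes "1 \<le> M"
  shows "discretized_return rew \<gamma> H M \<omega> \<le> total_return rew \<gamma> \<omega>"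
    and "total_return rew \<gamma> \<omega> \<le> discretized_return rew \<gamma> H M \<omega> + 1 / real M + \<gamma> ^ H"
proof -
  have 1: "truncated_return rew \<gamma> H \<omega> \<le> total_return rew \<gamma> \<omega>"
    "total_return rew \<gamma> \<omega> \<le> truncated_return rew \<gamma> H \<omega> + \<gamma> ^ H"
    unfolding total_return_eq_truncated[of \<omega> H]
    using total_return_bounds[of "\<lambda>i. \<omega> (H + i)"] \<gamma>_pos by (auto simp: mult_left_le)
  have 2: "discretized_return rew \<gamma> H M \<omega> \<le> truncated_return rew \<gamma> H \<omega>"
    using assms of_int_floor_le[of "real M * truncated_return rew \<gamma> H \<omega>"]
    by (simp add: discretized_return_def field_simps)
  have "real M * truncated_return rew \<gamma> H \<omega> \<le> of_int \<lfloor>real M * truncated_return rew \<gamma> H \<omega>\<rfloor> + 1"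
    by linarith
  then have 3: "truncated_return rew \<gamma> H \<omega> \<le> discretized_return rew \<gamma> H M \<omega> + 1 / real M"
    using assms by (simp add: discretized_return_def field_simps)
  show "discretized_return rew \<gamma> H M \<omega> \<le> total_return rew \<gamma> \<omega>"
    and "total_return rew \<gamma> \<omega> \<le> discretized_return rew \<gamma> H M \<omega> + 1 / real M + \<gamma> ^ H"
    using 1 2 3 by linarith+
qed

lemma discretized_return_in_levels:
  assumes "1 \<le> M"
  shows "discretized_return rew \<gamma> H M \<omega> \<in> return_levels M"
proof -
  let ?x = "real M * truncated_return rew \<gamma> H \<omega>"
  \<comment> \<open>The level 1 is missing from \<open>return_levels M\<close>. It is never reached,
    because the cut-off tail has positive weight \<open>\<gamma> ^ H\<close>.\<close>
  have "truncated_return rew \<gamma> H \<omega> < 1"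
    using truncated_return_bounds(2)[of H \<omega>] \<gamma>_pos by (smt (verit) zero_less_power)
  then have lt: "?x < real M" using assms by simp
  have ge: "0 \<le> ?x" using truncated_return_bounds(1)[of H \<omega>] by simp
  have "nat \<lfloor>?x\<rfloor> < M" using lt ge assms by linarith
  moreover have "discretized_return rew \<gamma> H M \<omega> = real (nat \<lfloor>?x\<rfloor>) / real M"
    using ge by (simp add: discretized_return_def)
  ultimately show ?thesis unfolding return_levels_def by blast
qed

end

subsection \<open>Learning the return distributions\<close>

locale learner = discounted_rewards rew \<gamma>
  for rew :: "'r::finite \<Rightarrow> real" and \<gamma> :: real +
  fixes H M N :: nat
    and \<pi> :: "('a::finite, 'o::finite, 'r) policy"
    and \<nu> :: "('a, 'o, 'r) environment"
  assumes H: "1 \<le> H" and M: "1 \<le> M" and HN: "H \<le> N"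
begin

abbreviation disc :: "('a, 'o, 'r) outcome \<Rightarrow> real" where
  "disc \<equiv> discretized_return rew \<gamma> H M"

abbreviation law :: "('a, 'o, 'r) outcome measure" where
  "law \<equiv> interaction \<pi> \<nu> []"

text \<open>This is the true return-predictor of the grain of truth, read on stripped
  histories.\<close>

definition return_prob :: "('a, 'o, 'r) history \<Rightarrow> 'a \<Rightarrow> real \<Rightarrow> real" where
  "return_prob h a z = measure (interaction_act \<pi> \<nu> h a) {\<omega>. disc \<omega> = z}"

lemma disc_in_levels: "disc \<omega> \<in> return_levels M"
  by (rule discretized_return_in_levels[OF M])

lemma sets_disc: "{\<omega>. disc \<omega> = z} \<in> sets outcomes"
  using measurable_sets[OF measurable_discretized_return, of "{z}" rew \<gamma> H M]
  by (simp add: space_PiM vimage_def)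

lemma return_prob_bounds: "0 \<le> return_prob h a z" "return_prob h a z \<le> 1"
  unfolding return_prob_def using prob_space.prob_le_1[OF prob_space_interaction_act] by auto

lemma integral_act_disc:
  "(\<integral>\<omega>. F (disc \<omega>) \<partial>interaction_act \<pi> \<nu> h a) = (\<Sum>z\<in>return_levels M. F z * return_prob h a z)"
proof -
  interpret prob_space "interaction_act \<pi> \<nu> h a" by (rule prob_space_interaction_act)
  have "F (disc \<omega>) = (\<Sum>z\<in>return_levels M. F z * indicator {\<omega>. disc \<omega> = z} \<omega>)" for \<omega>
  proof -
    have "(\<Sum>z\<in>return_levels M. F z * indicator {\<omega>. disc \<omega> = z} \<omega>) = (\<Sum>z\<in>return_levels M. if disc \<omega> = z then F z else 0)"
      by (intro sum.cong) auto
    then show ?thesis using disc_in_levels[of \<omega>] by (simp add: sum.delta)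
  qed
  then have "(\<integral>\<omega>. F (disc \<omega>) \<partial>interaction_act \<pi> \<nu> h a) =
      (\<integral>\<omega>. (\<Sum>z\<in>return_levels M. F z * indicator {\<omega>. disc \<omega> = z} \<omega>) \<partial>interaction_act \<pi> \<nu> h a)"
    by simp
  also have "\<dots> = (\<Sum>z\<in>return_levels M. F z * return_prob h a z)"
    using sets_disc by (subst Bochner_Integration.integral_sum) (auto simp: return_prob_def emeasure_eq_measure)
  finally show ?thesis .
qed

lemma sum_return_prob: "(\<Sum>z\<in>return_levels M. return_prob h a z) = 1"
proof -
  interpret prob_space "interaction_act \<pi> \<nu> h a" by (rule prob_space_interaction_act)
  show ?thesis using integral_act_disc[where F = "\<lambda>_. 1"] prob_space by simp
qed

text \<open>Given the first \<open>j\<close> blocks, the next action is drawn from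
  \<open>\<pi>\<close> and the return from \<open>return_prob\<close>. This is the Markov property
  followed by the disintegration over the first action; how returns at different times depend on
  each other never enters.\<close>

lemma
  fixes G :: "('a, 'o, 'r) history \<Rightarrow> 'a \<Rightarrow> real \<Rightarrow> real"
  shows integral_step: "(\<integral>\<omega>. G (map \<omega> [0..<j]) (fst (\<omega> j)) (disc (\<lambda>i. \<omega> (j + i))) \<partial>law) =
      (\<integral>\<omega>. (\<integral>a. (\<Sum>z\<in>return_levels M. G (map \<omega> [0..<j]) a z * return_prob (map \<omega> [0..<j]) a z)
        \<partial>\<pi> (map \<omega> [0..<j])) \<partial>law)"
    and integrable_step: "integrable law (\<lambda>\<omega>. G (map \<omega> [0..<j]) (fst (\<omega> j)) (disc (\<lambda>i. \<omega> (j + i))))"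
proof -
  have meas: "(\<lambda>\<omega>. G g (fst (\<omega> 0)) (disc \<omega>)) \<in> borel_measurable outcomes" for g
    by (rule measurable_compose_countable[OF measurable_discretized_return_fun
        measurable_compose[where g = fst, OF measurable_component_singleton]]) auto
  have bound: "\<bar>G g a (disc \<omega>)\<bar> \<le> (\<Sum>b\<in>UNIV. \<Sum>z\<in>return_levels M. \<bar>G g b z\<bar>)" for g a \<omega>
  proof -
    have "\<bar>G g a (disc \<omega>)\<bar> \<le> (\<Sum>z\<in>return_levels M. \<bar>G g a z\<bar>)"
      using disc_in_levels[of \<omega>] by (intro member_le_sum[of _ _ "\<lambda>z. \<bar>G g a z\<bar>"]) auto
    also have "\<dots> \<le> (\<Sum>b\<in>UNIV. \<Sum>z\<in>return_levels M. \<bar>G g b z\<bar>)"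
      by (intro member_le_sum[of _ _ "\<lambda>b. \<Sum>z\<in>return_levels M. \<bar>G g b z\<bar>"]) (auto intro: sum_nonneg)
    finally show ?thesis .
  qed
  have inner: "(\<integral>\<omega>. G g (fst (\<omega> 0)) (disc \<omega>) \<partial>interaction \<pi> \<nu> g) =
      (\<integral>a. (\<Sum>z\<in>return_levels M. G g a z * return_prob g a z) \<partial>\<pi> g)" for g
    using integral_interaction_split[of "\<lambda>a \<omega>. G g a (disc \<omega>)", OF measurable_discretized_return_fun bound]
    by (simp add: integral_act_disc)
  show "(\<integral>\<omega>. G (map \<omega> [0..<j]) (fst (\<omega> j)) (disc (\<lambda>i. \<omega> (j + i))) \<partial>law) =
      (\<integral>\<omega>. (\<integral>a. (\<Sum>z\<in>return_levels M. G (map \<omega> [0..<j]) a z * return_prob (map \<omega> [0..<j]) a z)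
        \<partial>\<pi> (map \<omega> [0..<j])) \<partial>law)"
    using integral_interaction_Markov[of "\<lambda>g \<omega>. G g (fst (\<omega> 0)) (disc \<omega>)", OF meas bound, of \<pi> \<nu> "[]" j]
    by (simp add: inner)
  show "integrable law (\<lambda>\<omega>. G (map \<omega> [0..<j]) (fst (\<omega> j)) (disc (\<lambda>i. \<omega> (j + i))))"
    using integrable_prefix_suffix[of "\<lambda>g \<omega>. G g (fst (\<omega> 0)) (disc \<omega>)", OF meas bound, of \<pi> \<nu> "[]" j]
    by simp
qed

text \<open>A level of conditional probability 0 is almost surely not the realised one: in the
  expected indicator of this event every summand has a factor 0. It makes the quotients of predicted
  and true probabilities meaningful.\<close>

lemma AE_return_prob_pos:
  "AE \<omega> in law. 0 < return_prob (map \<omega> [0..<j]) (fst (\<omega> j)) (disc (\<lambda>i. \<omega> (j + i)))"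
proof -
  let ?G = "\<lambda>g a z. if return_prob g a z = 0 then 1 else 0 :: real"
  let ?F = "\<lambda>\<omega>. ?G (map \<omega> [0..<j]) (fst (\<omega> j)) (disc (\<lambda>i. \<omega> (j + i)))"
  have "(\<Sum>z\<in>return_levels M. ?G g a z * return_prob g a z) = 0" for g a
    by (intro sum.neutral) auto
  then have "(\<integral>\<omega>. ?F \<omega> \<partial>law) = 0"
    by (simp add: integral_step[of ?G j])
  then have "AE \<omega> in law. ?F \<omega> = 0"
    by (subst (asm) integral_nonneg_eq_0_iff_AE[OF integrable_step[of ?G j]]) auto
  then show ?thesis
  proof eventually_elim
    case (elim \<omega>)
    then show ?case
      using return_prob_bounds(1)[of "map \<omega> [0..<j]" "fst (\<omega> j)" "disc (\<lambda>i. \<omega> (j + i))"]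
      by (auto split: if_splits)
  qed
qed

end

section \<open>Dominance of the mixtures over the true return-predictor\<close>

locale predicting_learner = learner rew \<gamma> H M N \<pi> \<nu>
  for rew :: "'r::finite \<Rightarrow> real" and \<gamma> :: real and H M N :: nat
    and \<pi> :: "('a::finite, 'o::finite, 'r) policy" and \<nu> :: "('a, 'o, 'r) environment" +
  fixes P :: "nat \<Rightarrow> ('a, 'o, 'r) predictor set"
    and w :: "nat \<Rightarrow> ('a, 'o, 'r) predictor \<Rightarrow> real"
    and \<psi>s :: "nat \<Rightarrow> ('a, 'o, 'r) predictor"
    and \<psi> :: "('a, 'o, 'r) history \<Rightarrow> 'a \<Rightarrow> real pmf"
  assumes classes: "\<And>n. n < N \<Longrightarrow> predictor_class M N n (P n) (w n)"
    and mixtures: "\<And>n. n < N \<Longrightarrow> is_mixture M N n (P n) (w n) (\<psi>s n)"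
    and unified: "\<psi> = unified_predictor rew \<gamma> H M N \<psi>s"
    and grain: "grain_of_truth rew \<gamma> H M N P \<pi> \<nu>"
begin

lemma N_pos: "0 < N" using H HN by simp

lemma aug_history_in_domain:
  "aug_history rew \<gamma> H M N ((length h + 1) mod N) h \<in> predictor_domain M N ((length h + 1) mod N)"
  by (auto simp: predictor_domain_def aug_histories_def aug_history_def aug_def aug_symbol_def discretized_return_in_levels[OF M]
      intro!: imageI)

lemma aug_in_histories: "map (aug rew \<gamma> H M N n \<omega>) [0..<T] \<in> aug_histories M N n"
  by (auto simp: aug_histories_def aug_def aug_symbol_def discretized_return_in_levels[OF M]
      intro!: imageI)

text \<open>At a position \<open>j\<close> of the phase, the return windows of all earlier positions
  of that phase have closed, since \<open>H \<le> N\<close>. The augmented prefix is thus computable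
  from the first \<open>j\<close> blocks, and each factor becomes a prediction made at an ordinary
  history.\<close>

lemma symbols_likelihood_aug:
  "symbols_likelihood N n \<phi> (map (aug rew \<gamma> H M N n \<omega>) [0..<T]) =
    (\<Prod>j | j < T \<and> (j + 1) mod N = n.
      pmf (\<phi> (aug_history rew \<gamma> H M N n (map \<omega> [0..<j])) (fst (\<omega> j))) (disc (\<lambda>i. \<omega> (j + i))))"
  unfolding symbols_likelihood_def
proof (intro prod.cong, goal_cases)
  case (2 j)
  then have j: "j < T" "(j + 1) mod N = n" by auto
  have "take j (map (aug rew \<gamma> H M N n \<omega>) [0..<T]) = map (aug rew \<gamma> H M N n \<omega>) [0..<j]"
    using j by (simp add: take_map)
  also have "\<dots> = aug_history rew \<gamma> H M N n (map \<omega> [0..<j])"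
    using aug_history_eq[of H N n "map \<omega> [0..<j]" \<omega> rew \<gamma> M] j H HN by simp
  finally have *: "take j (map (aug rew \<gamma> H M N n \<omega>) [0..<T]) = aug_history rew \<gamma> H M N n (map \<omega> [0..<j])" .
  show ?case
    unfolding * using j by (simp add: aug_def aug_symbol_def aug_action_def)
qed simp

lemma mixture_dominates:
  assumes "n < N" "\<phi> \<in> P n" "g \<in> aug_histories M N n"
  shows "w n \<phi> * symbols_likelihood N n \<phi> g \<le> symbols_likelihood N n (\<psi>s n) g"
proof -
  have L: "0 \<le> symbols_likelihood N n \<phi> g" "symbols_likelihood N n \<phi> g \<le> 1" for \<phi>
    unfolding symbols_likelihood_def by (auto intro!: prod_nonneg prod_le_1 simp: pmf_le_1)
  have w: "\<And>\<phi>. \<phi> \<in> P n \<Longrightarrow> 0 < w n \<phi>" "w n summable_on P n"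
    using classes[OF assms(1)] by (auto simp: predictor_class_def has_sum_imp_summable)
  \<comment> \<open>A divergent infinite sum has the value 0 by convention, so summability must be
    settled before a single term can be compared with the sum.\<close>
  have "(\<lambda>\<phi>. w n \<phi> * symbols_likelihood N n \<phi> g) summable_on P n"
    using L w(1) by (intro summable_on_comparison_test[OF w(2)]) (auto simp: mult_left_le less_imp_le)
  then have "(\<Sum>\<^sub>\<infinity>\<phi>\<in>{\<phi>}. w n \<phi> * symbols_likelihood N n \<phi> g) \<le> (\<Sum>\<^sub>\<infinity>\<phi>\<in>P n. w n \<phi> * symbols_likelihood N n \<phi> g)"
    using L w(1) assms(2) by (intro infsum_mono_neutral) (auto simp: less_imp_le)
  then show ?thesis
    using mixtures[OF assms(1)] assms(3) by (simp add: is_mixture_def)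
qed

definition pred_prob :: "('a, 'o, 'r) history \<Rightarrow> 'a \<Rightarrow> real \<Rightarrow> real" where
  "pred_prob h a z = pmf (\<psi> h a) z"

lemma \<psi>_eq: "\<psi> h a = \<psi>s ((length h + 1) mod N) (aug_history rew \<gamma> H M N ((length h + 1) mod N) h) a"
  by (simp add: unified unified_predictor_def Let_def)

lemma sum_pred_prob: "(\<Sum>z\<in>return_levels M. pred_prob h a z) = 1"
proof -
  have "(length h + 1) mod N < N" using N_pos by simp
  then have "set_pmf (\<psi> h a) \<subseteq> return_levels M"
    using mixtures[of "(length h + 1) mod N"] aug_history_in_domain[of h]
    by (auto simp: \<psi>_eq is_mixture_def return_predictor_def)
  then show ?thesis
    unfolding pred_prob_def by (intro sum_pmf_eq_1) auto
qed

text \<open>The constant is the prior weight of the true predictor. That it depends neither on the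
  path nor on \<open>T\<close> is what keeps the accumulated prediction error finite.\<close>

lemma likelihood_ratio_bound:
  assumes "n < N"
  obtains c where "0 < c" and "\<And>T \<omega>.
    c * (\<Prod>j | j < T \<and> (j + 1) mod N = n. return_prob (map \<omega> [0..<j]) (fst (\<omega> j)) (disc (\<lambda>i. \<omega> (j + i))))
      \<le> (\<Prod>j | j < T \<and> (j + 1) mod N = n. pred_prob (map \<omega> [0..<j]) (fst (\<omega> j)) (disc (\<lambda>i. \<omega> (j + i))))"
proof -
  obtain \<phi> where \<phi>: "\<phi> \<in> P n" and eq: "\<And>g a z. g \<in> predictor_domain M N n \<Longrightarrow> z \<in> return_levels M \<Longrightarrow>
      pmf (\<phi> g a) z = return_prob (strip g) a z"
    using grain assms unfolding grain_of_truth_def return_prob_def by blast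
  have "w n \<phi> * (\<Prod>j | j < T \<and> (j + 1) mod N = n. return_prob (map \<omega> [0..<j]) (fst (\<omega> j)) (disc (\<lambda>i. \<omega> (j + i))))
      \<le> (\<Prod>j | j < T \<and> (j + 1) mod N = n. pred_prob (map \<omega> [0..<j]) (fst (\<omega> j)) (disc (\<lambda>i. \<omega> (j + i))))" for T \<omega>
  proof -
    have "symbols_likelihood N n \<phi> (map (aug rew \<gamma> H M N n \<omega>) [0..<T]) =
      (\<Prod>j | j < T \<and> (j + 1) mod N = n. return_prob (map \<omega> [0..<j]) (fst (\<omega> j)) (disc (\<lambda>i. \<omega> (j + i))))"
      unfolding symbols_likelihood_aug
    proof (intro prod.cong refl)
      fix j assume "j \<in> {j. j < T \<and> (j + 1) mod N = n}"
      then have "aug_history rew \<gamma> H M N n (map \<omega> [0..<j]) \<in> predictor_domain M N n"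
        using aug_history_in_domain[of "map \<omega> [0..<j]"] by simp
      then show "pmf (\<phi> (aug_history rew \<gamma> H M N n (map \<omega> [0..<j])) (fst (\<omega> j))) (disc (\<lambda>i. \<omega> (j + i))) =
          return_prob (map \<omega> [0..<j]) (fst (\<omega> j)) (disc (\<lambda>i. \<omega> (j + i)))"
        by (simp add: eq disc_in_levels strip_aug_history)
    qed
    moreover have "symbols_likelihood N n (\<psi>s n) (map (aug rew \<gamma> H M N n \<omega>) [0..<T]) =
      (\<Prod>j | j < T \<and> (j + 1) mod N = n. pred_prob (map \<omega> [0..<j]) (fst (\<omega> j)) (disc (\<lambda>i. \<omega> (j + i))))"
      unfolding symbols_likelihood_aug
      by (intro prod.cong refl) (auto simp: pred_prob_def \<psi>_eq)
    ultimately show ?thesis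
      using mixture_dominates[OF assms \<phi> aug_in_histories, of \<omega> T] by simp
  qed
  moreover have "0 < w n \<phi>" using classes[OF assms] \<phi> by (simp add: predictor_class_def)
  ultimately show ?thesis using that by blast
qed

text \<open>One minus the Bhattacharyya coefficient, that is, the squared Hellinger distance. In
  this form it is an expectation under the true probabilities, see
  \<open>integral_sqrt_ratio\<close>; the form as a sum of squares is
  \<open>hellinger_eq\<close>.\<close>

definition hellinger :: "('a, 'o, 'r) history \<Rightarrow> 'a \<Rightarrow> real" where
  "hellinger h a = 1 - (\<Sum>z\<in>return_levels M. sqrt (pred_prob h a z * return_prob h a z))"

lemma pred_prob_nonneg: "0 \<le> pred_prob h a z"
  by (simp add: pred_prob_def)

lemma hellinger_eq:
  "2 * hellinger h a = (\<Sum>z\<in>return_levels M. (sqrt (pred_prob h a z) - sqrt (return_prob h a z))\<^sup>2)"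
proof -
  have "(\<Sum>z\<in>return_levels M. (sqrt (pred_prob h a z) - sqrt (return_prob h a z))\<^sup>2) =
    (\<Sum>z\<in>return_levels M. pred_prob h a z + return_prob h a z - 2 * sqrt (pred_prob h a z * return_prob h a z))"
    by (intro sum.cong refl) (simp add: power2_diff pred_prob_nonneg return_prob_bounds real_sqrt_mult)
  also have "\<dots> = 2 * hellinger h a"
    by (simp add: sum.distrib sum_subtractf sum_pred_prob sum_return_prob hellinger_def flip: sum_distrib_left)
  finally show ?thesis ..
qed

lemma hellinger_nonneg: "0 \<le> hellinger h a"
proof -
  have "0 \<le> 2 * hellinger h a" unfolding hellinger_eq by (intro sum_nonneg) simp
  then show ?thesis by simp
qed

text \<open>By AM-GM, the distance of the expectations is controlled by an arbitrarily small constant plus a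
  multiple of \<open>hellinger\<close> itself instead of its square root.\<close>

lemma expectation_diff_le:
  assumes "0 < \<theta>"
  shows "\<bar>(\<Sum>z\<in>return_levels M. z * pred_prob h a z) - (\<Sum>z\<in>return_levels M. z * return_prob h a z)\<bar>
    \<le> hellinger h a / (2 * \<theta>) + 4 * \<theta>"
proof -
  have le: "\<bar>p - q\<bar> \<le> (sqrt p - sqrt q)\<^sup>2 / (4 * \<theta>) + 2 * \<theta> * (p + q)" if "0 \<le> p" "0 \<le> q" for p q :: real
  proof -
    define x y where "x = sqrt p" and "y = sqrt q"
    have xy: "p = x\<^sup>2" "q = y\<^sup>2" using that by (auto simp: x_def y_def)
    \<comment> \<open>With square roots, |p - q| factors as |x - y| * |x + y|. The weight
      \<open>2 * \<theta>\<close> puts the small coefficient on the second factor, whose square is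
      at most 2 * (p + q).\<close>
    have "0 \<le> (\<bar>x - y\<bar> - 2 * \<theta> * \<bar>x + y\<bar>)\<^sup>2" by simp
    then have "4 * \<theta> * (\<bar>x - y\<bar> * \<bar>x + y\<bar>) \<le> (x - y)\<^sup>2 + 4 * \<theta>\<^sup>2 * (x + y)\<^sup>2"
      by (simp add: power2_diff power_mult_distrib algebra_simps)
    also have "4 * \<theta>\<^sup>2 * (x + y)\<^sup>2 \<le> 4 * \<theta>\<^sup>2 * (2 * (x\<^sup>2 + y\<^sup>2))"
      using sum_squares_bound[of x y] by (intro mult_left_mono) (auto simp: power2_sum)
    finally have "\<bar>x - y\<bar> * \<bar>x + y\<bar> \<le> ((x - y)\<^sup>2 + 4 * \<theta>\<^sup>2 * (2 * (x\<^sup>2 + y\<^sup>2))) / (4 * \<theta>)"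
      using assms by (simp add: field_simps)
    also have "\<dots> = (x - y)\<^sup>2 / (4 * \<theta>) + 2 * \<theta> * (x\<^sup>2 + y\<^sup>2)"
      using assms by (simp add: field_simps power2_eq_square)
    finally have "\<bar>p - q\<bar> \<le> (x - y)\<^sup>2 / (4 * \<theta>) + 2 * \<theta> * (p + q)"
      unfolding xy by (simp add: power2_eq_square square_diff_square_factored abs_mult mult.commute)
    then show ?thesis by (simp add: x_def y_def)
  qed
  have "\<bar>(\<Sum>z\<in>return_levels M. z * pred_prob h a z) - (\<Sum>z\<in>return_levels M. z * return_prob h a z)\<bar>
    = \<bar>\<Sum>z\<in>return_levels M. z * (pred_prob h a z - return_prob h a z)\<bar>"
    by (simp add: sum_subtractf right_diff_distrib)
  also have "\<dots> \<le> (\<Sum>z\<in>return_levels M. \<bar>z * (pred_prob h a z - return_prob h a z)\<bar>)"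
    by (rule sum_abs)
  also have "\<dots> \<le> (\<Sum>z\<in>return_levels M. (sqrt (pred_prob h a z) - sqrt (return_prob h a z))\<^sup>2 / (4 * \<theta>)
      + 2 * \<theta> * (pred_prob h a z + return_prob h a z))"
  proof (rule sum_mono)
    fix z assume "z \<in> return_levels M"
    then have "\<bar>z * (pred_prob h a z - return_prob h a z)\<bar> \<le> \<bar>pred_prob h a z - return_prob h a z\<bar>"
      unfolding abs_mult by (intro mult_left_le_one_le abs_return_level_le) auto
    with le[OF pred_prob_nonneg return_prob_bounds(1), of h a z h a z]
    show "\<bar>z * (pred_prob h a z - return_prob h a z)\<bar> \<le> (sqrt (pred_prob h a z) - sqrt (return_prob h a z))\<^sup>2 / (4 * \<theta>)
      + 2 * \<theta> * (pred_prob h a z + return_prob h a z)" by linarith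
  qed
  \<comment> \<open>Both distributions have total mass 1, so the terms
    \<open>2 * \<theta> * (p + q)\<close> add up to \<open>4 * \<theta>\<close>.\<close>
  also have "\<dots> = 2 * hellinger h a / (4 * \<theta>) + 4 * \<theta>"
    by (simp add: sum.distrib sum_pred_prob sum_return_prob hellinger_eq
        flip: sum_divide_distrib sum_distrib_left)
  finally show ?thesis by simp
qed

text \<open>Weighting sqrt (p / q) by q gives sqrt (p * q), also at levels with q = 0, where both
  vanish. Hence the mean over the return is exactly \<open>hellinger\<close>.\<close>

lemma integral_sqrt_ratio:
  "(\<integral>\<omega>. 1 - sqrt (pred_prob (map \<omega> [0..<j]) (fst (\<omega> j)) (disc (\<lambda>i. \<omega> (j + i))) /
        return_prob (map \<omega> [0..<j]) (fst (\<omega> j)) (disc (\<lambda>i. \<omega> (j + i)))) \<partial>law) =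
    (\<integral>\<omega>. (\<integral>a. hellinger (map \<omega> [0..<j]) a \<partial>\<pi> (map \<omega> [0..<j])) \<partial>law)"
proof -
  have *: "sqrt (p / q) * q = sqrt (p * q)" if "0 \<le> q" for p q :: real
    using that by (cases "q = 0") (auto simp: real_sqrt_divide real_sqrt_mult real_div_sqrt field_simps)
  have "(\<Sum>z\<in>return_levels M. (1 - sqrt (pred_prob h a z / return_prob h a z)) * return_prob h a z) = hellinger h a" for h a
    by (simp add: left_diff_distrib * return_prob_bounds sum_subtractf sum_return_prob hellinger_def)
  then show ?thesis
    by (subst integral_step[of "\<lambda>h a z. 1 - sqrt (pred_prob h a z / return_prob h a z)"]) simp
qed

text \<open>Since \<open>2 * (1 - sqrt x) \<le> - ln x\<close>, the expected distances sum up to at most half the logarithm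
  of the inverse prior weight of the true predictor.\<close>

lemma sum_integral_hellinger_bounded:
  assumes "n < N"
  obtains C where "\<And>T. (\<Sum>j | j < T \<and> (j + 1) mod N = n.
    (\<integral>\<omega>. (\<integral>a. hellinger (map \<omega> [0..<j]) a \<partial>\<pi> (map \<omega> [0..<j])) \<partial>law)) \<le> C"
proof -
  obtain c where c: "0 < c" and le: "\<And>T \<omega>.
    c * (\<Prod>j | j < T \<and> (j + 1) mod N = n. return_prob (map \<omega> [0..<j]) (fst (\<omega> j)) (disc (\<lambda>i. \<omega> (j + i))))
      \<le> (\<Prod>j | j < T \<and> (j + 1) mod N = n. pred_prob (map \<omega> [0..<j]) (fst (\<omega> j)) (disc (\<lambda>i. \<omega> (j + i))))"
    using likelihood_ratio_bound[OF assms] by blast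
  interpret law: prob_space law by (rule prob_space_interaction)
  define p where "p \<omega> j = pred_prob (map \<omega> [0..<j]) (fst (\<omega> j)) (disc (\<lambda>i. \<omega> (j + i)))" for \<omega> j
  define q where "q \<omega> j = return_prob (map \<omega> [0..<j]) (fst (\<omega> j)) (disc (\<lambda>i. \<omega> (j + i)))" for \<omega> j
  have "(\<Sum>j | j < T \<and> (j + 1) mod N = n.
    (\<integral>\<omega>. (\<integral>a. hellinger (map \<omega> [0..<j]) a \<partial>\<pi> (map \<omega> [0..<j])) \<partial>law)) \<le> - ln c / 2" for T
  proof -
    let ?J = "{j. j < T \<and> (j + 1) mod N = n}"
    have int: "integrable law (\<lambda>\<omega>. 1 - sqrt (p \<omega> j / q \<omega> j))" for j
      unfolding p_def q_def
      by (rule integrable_step[of "\<lambda>h a z. 1 - sqrt (pred_prob h a z / return_prob h a z)"])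
    have "AE \<omega> in law. \<forall>j. 0 < q \<omega> j"
      unfolding AE_all_countable q_def using AE_return_prob_pos by blast
    then have AE: "AE \<omega> in law. (\<Sum>j\<in>?J. 1 - sqrt (p \<omega> j / q \<omega> j)) \<le> - ln c / 2"
    proof eventually_elim
      case (elim \<omega>)
      have le': "c * (\<Prod>j\<in>?J. q \<omega> j) \<le> (\<Prod>j\<in>?J. p \<omega> j)"
        unfolding p_def q_def by (rule le)
      have q: "0 < (\<Prod>j\<in>?J. q \<omega> j)" using elim by (intro prod_pos) auto
      \<comment> \<open>Dominance carries positivity over: once the true probabilities along the
        path are positive, no prediction along it can be 0, and logarithms may be taken.\<close>
      have "(\<Prod>j\<in>?J. p \<omega> j) \<noteq> 0" using le' mult_pos_pos[OF c q] by linarith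
      then have p: "0 < p \<omega> j" if "j \<in> ?J" for j
        using that pred_prob_nonneg[of "map \<omega> [0..<j]"]
        by (simp add: p_def prod_zero_iff less_eq_real_def) (metis)
      have pq: "0 < p \<omega> j / q \<omega> j" if "j \<in> ?J" for j
        using that elim p by (intro divide_pos_pos) auto
      have "ln c \<le> ln (\<Prod>j\<in>?J. p \<omega> j / q \<omega> j)"
        using c q le' by (subst ln_le_cancel_iff) (auto simp: prod_dividef field_simps elim p intro!: prod_pos divide_pos_pos)
      also have "\<dots> = (\<Sum>j\<in>?J. ln (p \<omega> j / q \<omega> j))"
        by (rule ln_prod) (simp, drule pq, auto)
      also have "\<dots> \<le> (\<Sum>j\<in>?J. - 2 * (1 - sqrt (p \<omega> j / q \<omega> j)))"
      proof (rule sum_mono)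
        fix j assume j: "j \<in> ?J"
        from pq[OF j] have "ln (p \<omega> j / q \<omega> j) = 2 * ln (sqrt (p \<omega> j / q \<omega> j))"
          by (simp add: ln_sqrt)
        also have "\<dots> \<le> 2 * (sqrt (p \<omega> j / q \<omega> j) - 1)"
          using pq[OF j] by (intro mult_left_mono ln_le_minus_one) auto
        finally show "ln (p \<omega> j / q \<omega> j) \<le> - 2 * (1 - sqrt (p \<omega> j / q \<omega> j))" by simp
      qed
      finally have "ln c \<le> - 2 * (\<Sum>j\<in>?J. 1 - sqrt (p \<omega> j / q \<omega> j))"
        unfolding sum_distrib_left .
      then show ?case by linarith
    qed
    have "(\<Sum>j\<in>?J. (\<integral>\<omega>. (\<integral>a. hellinger (map \<omega> [0..<j]) a \<partial>\<pi> (map \<omega> [0..<j])) \<partial>law)) =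
        (\<Sum>j\<in>?J. (\<integral>\<omega>. 1 - sqrt (p \<omega> j / q \<omega> j) \<partial>law))"
      unfolding p_def q_def integral_sqrt_ratio ..
    also have "\<dots> = (\<integral>\<omega>. (\<Sum>j\<in>?J. 1 - sqrt (p \<omega> j / q \<omega> j)) \<partial>law)"
      by (rule Bochner_Integration.integral_sum[symmetric]) (rule int)
    also have "\<dots> \<le> - ln c / 2"
      using int AE by (intro law.integral_le_const Bochner_Integration.integrable_sum)
    finally show ?thesis .
  qed
  then show ?thesis using that by blast
qed

end

subsection \<open>Expected sums along the interaction\<close>

lemma integral_pmf_UNIV: "(\<integral>x. f x \<partial>measure_pmf p) = (\<Sum>x\<in>UNIV. f x * pmf p x)"
  for f :: "'b::finite \<Rightarrow> real"
  by (rule integral_measure_pmf_real) auto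

text \<open>By monotone convergence the series of the \<open>F\<close> along the path has finite
  expectation. It therefore converges almost surely, and its terms tend to 0.\<close>

lemma AE_tendsto_zero:
  fixes \<pi> :: "('a::finite, 'o::finite, 'r::finite) policy" and F :: "_ \<Rightarrow> real"
  assumes nn: "\<And>h. 0 \<le> F h"
    and C: "\<And>T. (\<Sum>j<T. \<integral>\<omega>. F (map \<omega> [0..<j]) \<partial>interaction \<pi> \<nu> []) \<le> C"
  shows "AE \<omega> in interaction \<pi> \<nu> []. (\<lambda>j. F (map \<omega> [0..<j])) \<longlonglongrightarrow> 0"
proof -
  let ?I = "\<lambda>j. \<integral>\<omega>. F (map \<omega> [0..<j]) \<partial>interaction \<pi> \<nu> []"
  have I: "0 \<le> ?I j" for j by (intro Bochner_Integration.integral_nonneg nn)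
  have "summable ?I"
    by (intro bounded_imp_summable[of _ C]) (simp_all add: I C del: sum.lessThan_Suc flip: lessThan_Suc_atMost)
  have "(\<integral>\<^sup>+\<omega>. (\<Sum>j. ennreal (F (map \<omega> [0..<j]))) \<partial>interaction \<pi> \<nu> []) =
      (\<Sum>j. \<integral>\<^sup>+\<omega>. ennreal (F (map \<omega> [0..<j])) \<partial>interaction \<pi> \<nu> [])"
    by (intro nn_integral_suminf) measurable
  also have "\<dots> = (\<Sum>j. ennreal (?I j))"
    by (intro suminf_cong nn_integral_eq_integral integrable_prefix) (simp add: nn)
  also have "\<dots> = ennreal (\<Sum>j. ?I j)"
    by (intro suminf_ennreal2 I \<open>summable ?I\<close>)
  finally have "(\<integral>\<^sup>+\<omega>. (\<Sum>j. ennreal (F (map \<omega> [0..<j]))) \<partial>interaction \<pi> \<nu> []) \<noteq> \<infinity>" by simp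
  then have "AE \<omega> in interaction \<pi> \<nu> []. (\<Sum>j. ennreal (F (map \<omega> [0..<j]))) \<noteq> \<infinity>"
    by (rule nn_integral_PInf_AE[rotated]) measurable
  then show ?thesis
  proof eventually_elim
    case (elim \<omega>)
    then have "summable (\<lambda>j. F (map \<omega> [0..<j]))"
      by (intro summable_suminf_not_top nn) simp
    then show ?case by (rule summable_LIMSEQ_zero)
  qed
qed

lemma integral_next_block:
  fixes \<pi> :: "('a::finite, 'o::finite, 'r::finite) policy" and F :: "_ \<Rightarrow> real"
  shows "(\<integral>\<omega>. (\<integral>b. F (map \<omega> [0..<j] @ [b]) \<partial>block_pmf \<pi> \<nu> (map \<omega> [0..<j])) \<partial>interaction \<pi> \<nu> []) =
    (\<integral>\<omega>. F (map \<omega> [0..<Suc j]) \<partial>interaction \<pi> \<nu> [])"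
proof -
  have meas: "(\<lambda>\<omega> :: ('a, 'o, 'r) outcome. F (g @ [\<omega> 0])) \<in> borel_measurable outcomes" for g
    by (rule measurable_compose[where g = "\<lambda>b. F (g @ [b])", OF measurable_component_singleton]) auto
  have bound: "\<bar>F (g @ [\<omega> 0])\<bar> \<le> (\<Sum>b\<in>UNIV. \<bar>F (g @ [b])\<bar>)" for g and \<omega> :: "('a, 'o, 'r) outcome"
    by (intro member_le_sum[of _ _ "\<lambda>b. \<bar>F (g @ [b])\<bar>"]) auto
  have "(\<integral>\<omega>. F (g @ [\<omega> 0]) \<partial>interaction \<pi> \<nu> g) = (\<integral>b. F (g @ [b]) \<partial>block_pmf \<pi> \<nu> g)" for g
  proof -
    have "(\<integral>\<omega>. F (g @ [\<omega> 0]) \<partial>interaction \<pi> \<nu> g) =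
        (\<integral>b. (\<integral>\<omega>. F (g @ [case_nat b \<omega> 0]) \<partial>interaction \<pi> \<nu> (g @ [b])) \<partial>block_pmf \<pi> \<nu> g)"
      by (rule integral_interaction_block[OF meas]) (rule bound)
    then show ?thesis
      by (simp add: prob_space.prob_space[OF prob_space_interaction, simplified])
  qed
  \<comment> \<open>The index \<open>j + 0\<close> exhibits the next block as coordinate 0 of the
    suffix after \<open>j\<close> blocks, as the Markov property requires.\<close>
  moreover have "(\<integral>\<omega>. F (map \<omega> [0..<j] @ [\<omega> (j + 0)]) \<partial>interaction \<pi> \<nu> []) =
      (\<integral>\<omega>. (\<integral>\<omega>'. F (map \<omega> [0..<j] @ [\<omega>' 0]) \<partial>interaction \<pi> \<nu> ([] @ map \<omega> [0..<j])) \<partial>interaction \<pi> \<nu> [])"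
    by (rule integral_interaction_Markov[where f = "\<lambda>g \<omega>. F (g @ [\<omega> 0])" and B = "\<lambda>g. \<Sum>b\<in>UNIV. \<bar>F (g @ [b])\<bar>"])
      (rule meas, rule bound)
  ultimately show ?thesis by simp
qed

text \<open>
  \<open>lookahead \<pi> \<nu> \<beta> f K h\<close> is the sum over \<open>k < K\<close> of \<open>\<beta> ^ k\<close> times the expectation of \<open>f\<close> at the history
  \<open>k\<close> steps after \<open>h\<close>.
\<close>

primrec lookahead ::
  "('a, 'o, 'r) policy \<Rightarrow> ('a, 'o, 'r) environment \<Rightarrow> real \<Rightarrow> (('a, 'o, 'r) history \<Rightarrow> real) \<Rightarrow> nat \<Rightarrow>
    ('a, 'o, 'r) history \<Rightarrow> real" where
  "lookahead \<pi> \<nu> \<beta> f 0 h = 0"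
| "lookahead \<pi> \<nu> \<beta> f (Suc K) h = f h + \<beta> * (\<integral>b. lookahead \<pi> \<nu> \<beta> f K (h @ [b]) \<partial>block_pmf \<pi> \<nu> h)"

lemma lookahead_nonneg:
  assumes "0 \<le> \<beta>" "\<And>h. 0 \<le> f h"
  shows "0 \<le> lookahead \<pi> \<nu> \<beta> f K h"
  by (induction K arbitrary: h) (use assms in \<open>auto intro!: add_nonneg_nonneg mult_nonneg_nonneg Bochner_Integration.integral_nonneg\<close>)

text \<open>By the tower property, looking one block further ahead only shifts the time index of the
  expectation. The shifted partial sums obey the old bound because the dropped term at time 0 is
  nonnegative. The new bound \<open>C + \<beta> * C'\<close> may grow with \<open>K\<close>, but is
  finite for each \<open>K\<close>.\<close>

lemma sum_integral_lookahead_bounded: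
  fixes \<pi> :: "('a::finite, 'o::finite, 'r::finite) policy"
  assumes "0 \<le> \<beta>" "\<And>h. 0 \<le> f h"
    and "\<And>T. (\<Sum>j<T. \<integral>\<omega>. f (map \<omega> [0..<j]) \<partial>interaction \<pi> \<nu> []) \<le> C"
  shows "\<exists>C'. \<forall>T. (\<Sum>j<T. \<integral>\<omega>. lookahead \<pi> \<nu> \<beta> f K (map \<omega> [0..<j]) \<partial>interaction \<pi> \<nu> []) \<le> C'"
proof (induction K)
  case 0
  show ?case by auto
next
  case (Suc K)
  let ?L = "\<lambda>K j. \<integral>\<omega>. lookahead \<pi> \<nu> \<beta> f K (map \<omega> [0..<j]) \<partial>interaction \<pi> \<nu> []"
  from Suc obtain C' where C': "\<And>T. (\<Sum>j<T. ?L K j) \<le> C'" by blast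
  have step: "?L (Suc K) j = (\<integral>\<omega>. f (map \<omega> [0..<j]) \<partial>interaction \<pi> \<nu> []) + \<beta> * ?L K (Suc j)" for j
  proof -
    let ?N = "\<lambda>g. \<integral>b. lookahead \<pi> \<nu> \<beta> f K (g @ [b]) \<partial>block_pmf \<pi> \<nu> g"
    have "?L (Suc K) j = (\<integral>\<omega>. f (map \<omega> [0..<j]) + \<beta> * ?N (map \<omega> [0..<j]) \<partial>interaction \<pi> \<nu> [])" by simp
    also have "\<dots> = (\<integral>\<omega>. f (map \<omega> [0..<j]) \<partial>interaction \<pi> \<nu> []) + \<beta> * (\<integral>\<omega>. ?N (map \<omega> [0..<j]) \<partial>interaction \<pi> \<nu> [])"
      using integrable_prefix[of \<pi> \<nu> "[]" f j] integrable_prefix[of \<pi> \<nu> "[]" ?N j]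
      by (subst Bochner_Integration.integral_add) auto
    finally show ?thesis unfolding integral_next_block .
  qed
  have "(\<Sum>j<T. ?L (Suc K) j) \<le> C + \<beta> * C'" for T
  proof -
    have "0 \<le> ?L K 0"
      by (intro Bochner_Integration.integral_nonneg lookahead_nonneg assms)
    then have "(\<Sum>j<T. ?L K (Suc j)) \<le> (\<Sum>j<Suc T. ?L K j)"
      unfolding sum.lessThan_Suc_shift by linarith
    also have "\<dots> \<le> C'" by (rule C')
    finally have "\<beta> * (\<Sum>j<T. ?L K (Suc j)) \<le> \<beta> * C'"
      using assms(1) by (rule mult_left_mono)
    then show ?thesis
      unfolding step sum.distrib using assms(3)[of T] by (simp add: sum_distrib_left)
  qed
  then show ?case by blast
qed

subsection \<open>Near-optimality\<close>

context discounted_rewards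
begin

definition action_value :: "('a::finite, 'o::finite, 'r) policy \<Rightarrow> ('a, 'o, 'r) environment \<Rightarrow> ('a, 'o, 'r) history \<Rightarrow> 'a \<Rightarrow> real" where
  "action_value \<pi> \<nu> h a = (\<integral>\<omega>. total_return rew \<gamma> \<omega> \<partial>interaction_act \<pi> \<nu> h a)"

lemma policy_value_eq: "policy_value rew \<gamma> \<pi> \<nu> h = (\<Sum>a\<in>UNIV. action_value \<pi> \<nu> h a * pmf (\<pi> h) a)"
  for \<pi> :: "('a::finite, 'o::finite, 'r) policy"
  unfolding policy_value_def action_value_def
  using integral_interaction_split[of "\<lambda>_. total_return rew \<gamma>" 1 \<pi> \<nu> h,
      OF measurable_total_return abs_total_return_le]
  by (simp add: integral_pmf_UNIV)

lemma action_value_le_1: "action_value \<pi> \<nu> h a \<le> 1"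
  for \<pi> :: "('a::finite, 'o::finite, 'r) policy"
  using abs_integral_interaction_le[of "total_return rew \<gamma>" 1] abs_total_return_le
  unfolding action_value_def interaction_act_def by (smt (verit, best) measurable_total_return)

text \<open>One-step Bellman equation: the first reward is split off and the rest of the return is
  discounted once.\<close>

lemma action_value_eq:
  fixes \<pi> :: "('a::finite, 'o::finite, 'r) policy"
  shows "action_value \<pi> \<nu> h a =
    (\<Sum>e\<in>UNIV. ((1 - \<gamma>) * rew (snd e) + \<gamma> * policy_value rew \<gamma> \<pi> \<nu> (h @ [(a, e)])) * pmf (\<nu> h a) e)"
proof -
  have "total_return rew \<gamma> (case_nat (a, e) \<omega>) = (1 - \<gamma>) * rew (snd e) + \<gamma> * total_return rew \<gamma> \<omega>"
    for e and \<omega> :: "('a, 'o, 'r) outcome"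
    using total_return_eq_truncated[of "case_nat (a, e) \<omega>" 1] by (simp add: truncated_return_def reward_at_def)
  moreover have "integrable (interaction \<pi> \<nu> g) (total_return rew \<gamma>)" for g
    by (rule integrable_interaction[OF measurable_total_return abs_total_return_le])
  moreover have "integrable (interaction \<pi> \<nu> g) (\<lambda>_. c :: real)" for g c
    by (rule integrable_interaction[of _ "\<bar>c\<bar>"]) auto
  ultimately have "(\<integral>\<omega>. total_return rew \<gamma> (case_nat (a, e) \<omega>) \<partial>interaction \<pi> \<nu> (h @ [(a, e)])) =
      (1 - \<gamma>) * rew (snd e) + \<gamma> * policy_value rew \<gamma> \<pi> \<nu> (h @ [(a, e)])" for e
    by (simp add: policy_value_def prob_space.prob_space[OF prob_space_interaction, simplified])
  then show ?thesis
    unfolding action_value_def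
    by (subst integral_interaction_act[OF measurable_total_return abs_total_return_le]) (simp add: integral_pmf_UNIV)
qed

text \<open>
  Each step along \<open>\<pi>'\<close> instead of \<open>\<pi>\<close> changes the measure by a factor of at most \<open>1 / \<delta>\<close>, which is
  where exploration enters.
\<close>

lemma policy_value_diff_le:
  fixes \<pi> \<pi>' :: "('a::finite, 'o::finite, 'r) policy"
  assumes \<delta>: "0 < \<delta>" "\<And>h a. \<delta> \<le> pmf (\<pi> h) a"
    and f: "\<And>h. 0 \<le> f h"
    and gap: "\<And>h a. action_value \<pi> \<nu> h a - policy_value rew \<gamma> \<pi> \<nu> h \<le> c + f h"
  shows "policy_value rew \<gamma> \<pi>' \<nu> h - policy_value rew \<gamma> \<pi> \<nu> h \<le>
    \<gamma> ^ K + c * (\<Sum>k<K. \<gamma> ^ k) + lookahead \<pi> \<nu> (\<gamma> / \<delta>) f K h"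
proof (induction K arbitrary: h)
  case 0
  \<comment> \<open>Values lie in the unit interval, so without any lookahead the difference is at
    most 1, which is \<open>\<gamma> ^ 0\<close>.\<close>
  show ?case
    using policy_value_bounds[OF \<gamma>_pos \<gamma>_less_1 range_rew, of \<pi>' \<nu> h]
      policy_value_bounds[OF \<gamma>_pos \<gamma>_less_1 range_rew, of \<pi> \<nu> h] by simp
next
  case (Suc K)
  let ?V = "policy_value rew \<gamma>" and ?L = "lookahead \<pi> \<nu> (\<gamma> / \<delta>) f"
  define b where "b = \<gamma> ^ K + c * (\<Sum>k<K. \<gamma> ^ k)"
  define W where "W a = (\<Sum>e\<in>UNIV. ?L K (h @ [(a, e)]) * pmf (\<nu> h a) e)" for a
  have W: "0 \<le> W a" for a
    unfolding W_def using \<delta> \<gamma>_pos f by (intro sum_nonneg mult_nonneg_nonneg lookahead_nonneg) auto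
  have pmf_sum: "(\<Sum>x\<in>UNIV. pmf p x) = 1" for p :: "'x::finite pmf"
    by (rule sum_pmf_eq_1) auto
  have act: "action_value \<pi>' \<nu> h a - action_value \<pi> \<nu> h a \<le> \<gamma> * (b + W a)" for a
  proof -
    have "action_value \<pi>' \<nu> h a - action_value \<pi> \<nu> h a =
      \<gamma> * (\<Sum>e\<in>UNIV. (?V \<pi>' \<nu> (h @ [(a, e)]) - ?V \<pi> \<nu> (h @ [(a, e)])) * pmf (\<nu> h a) e)"
      unfolding action_value_eq by (simp add: sum_distrib_left sum_subtractf algebra_simps flip: sum.distrib)
    also have "\<dots> \<le> \<gamma> * (\<Sum>e\<in>UNIV. (b + ?L K (h @ [(a, e)])) * pmf (\<nu> h a) e)"
      using \<gamma>_pos Suc.IH by (intro mult_left_mono sum_mono mult_right_mono) (auto simp: b_def)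
    also have "\<dots> = \<gamma> * (b + W a)"
      by (simp add: W_def distrib_right sum.distrib pmf_sum flip: sum_distrib_left)
    finally show ?thesis .
  qed
  \<comment> \<open>The advantage is averaged over the competitor's first action. Inserting the
    action value of \<open>\<pi>\<close> separates what the competitor gains later
    (\<open>act\<close>) from what this one action gains (\<open>gap\<close>).\<close>
  have "?V \<pi>' \<nu> h - ?V \<pi> \<nu> h = (\<Sum>a\<in>UNIV. (action_value \<pi>' \<nu> h a - ?V \<pi> \<nu> h) * pmf (\<pi>' h) a)"
    by (simp add: policy_value_eq[of \<pi>'] left_diff_distrib sum_subtractf pmf_sum flip: sum_distrib_left)
  also have "\<dots> \<le> (\<Sum>a\<in>UNIV. (c + f h + \<gamma> * b + \<gamma> * W a) * pmf (\<pi>' h) a)"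
  proof (intro sum_mono mult_right_mono)
    show "action_value \<pi>' \<nu> h a - ?V \<pi> \<nu> h \<le> c + f h + \<gamma> * b + \<gamma> * W a" for a
      using act[of a] gap[of h a] by (simp add: algebra_simps)
  qed simp
  also have "\<dots> = c + f h + \<gamma> * b + \<gamma> * (\<Sum>a\<in>UNIV. W a * pmf (\<pi>' h) a)"
    by (simp add: distrib_right sum.distrib pmf_sum sum_distrib_left mult.assoc flip: sum_distrib_left)
  \<comment> \<open>Change of measure for one step, from
    \<open>\<pi>' h a \<le> 1 \<le> \<pi> h a / \<delta>\<close> for the action probabilities. It
    preserves the inequality because \<open>W\<close> is nonnegative.\<close>
  also have "(\<Sum>a\<in>UNIV. W a * pmf (\<pi>' h) a) \<le> (\<Sum>a\<in>UNIV. W a * (pmf (\<pi> h) a / \<delta>))"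
  proof (intro sum_mono mult_left_mono W)
    fix a
    have "\<delta> * pmf (\<pi>' h) a \<le> \<delta>" using \<delta>(1) pmf_le_1[of "\<pi>' h" a] by simp
    also note \<delta>(2)[of h a]
    finally show "pmf (\<pi>' h) a \<le> pmf (\<pi> h) a / \<delta>" using \<delta>(1) by (simp add: field_simps)
  qed
  also have "(\<Sum>a\<in>UNIV. W a * (pmf (\<pi> h) a / \<delta>)) = (\<integral>b. ?L K (h @ [b]) \<partial>block_pmf \<pi> \<nu> h) / \<delta>"
    by (subst integral_block_pmf) (simp add: integral_pmf_UNIV W_def sum_divide_distrib)
  finally show ?case
    using \<gamma>_pos by (simp add: b_def sum.lessThan_Suc_shift sum_distrib_left algebra_simps del: sum.lessThan_Suc)
qed

end

section \<open>Near-greediness of the AIQI policy\<close>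

locale aiqi = predicting_learner rew \<gamma> H M N \<pi> \<nu> P w \<psi>s \<psi>
  for rew :: "'r::finite \<Rightarrow> real" and \<gamma> :: real and H M N :: nat
    and \<pi> :: "('a::finite, 'o::finite, 'r) policy" and \<nu> :: "('a, 'o, 'r) environment"
    and P :: "nat \<Rightarrow> ('a, 'o, 'r) predictor set"
    and w :: "nat \<Rightarrow> ('a, 'o, 'r) predictor \<Rightarrow> real"
    and \<psi>s :: "nat \<Rightarrow> ('a, 'o, 'r) predictor"
    and \<psi> :: "('a, 'o, 'r) history \<Rightarrow> 'a \<Rightarrow> real pmf" +
  fixes \<tau> :: real
  assumes \<tau>: "0 < \<tau>" "\<tau> \<le> 1" and aiqi_policy: "is_AIQI_policy M \<tau> \<psi> \<pi>"
begin

lemma exploration: "\<tau> / real CARD('a) \<le> pmf (\<pi> h) a"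
proof -
  from aiqi_policy obtain p where "pmf (\<pi> h) a = (1 - \<tau>) * pmf p a + \<tau> / real CARD('a)"
    unfolding is_AIQI_policy_def by blast
  then show ?thesis using \<tau> by simp
qed

text \<open>Comparing a greedy action with an arbitrary one needs accurate predictions at both, not
  just at the action that happens to be sampled.\<close>

definition total_hellinger :: "('a, 'o, 'r) history \<Rightarrow> real" where
  "total_hellinger h = (\<Sum>a\<in>UNIV. hellinger h a)"

lemma total_hellinger_nonneg: "0 \<le> total_hellinger h"
  unfolding total_hellinger_def by (intro sum_nonneg hellinger_nonneg)

lemma hellinger_le_total: "hellinger h a \<le> total_hellinger h"
  unfolding total_hellinger_def by (intro member_le_sum) (auto intro: hellinger_nonneg)

lemma total_hellinger_le: "total_hellinger h \<le> real CARD('a) / \<tau> * (\<integral>a. hellinger h a \<partial>\<pi> h)"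
proof -
  have "\<tau> / real CARD('a) * total_hellinger h = (\<Sum>a\<in>UNIV. hellinger h a * (\<tau> / real CARD('a)))"
    by (simp add: total_hellinger_def sum_distrib_left mult.commute)
  also have "\<dots> \<le> (\<Sum>a\<in>UNIV. hellinger h a * pmf (\<pi> h) a)"
    by (intro sum_mono mult_left_mono exploration hellinger_nonneg)
  finally show ?thesis using \<tau>(1) by (simp add: integral_pmf_UNIV field_simps)
qed

lemma sum_integral_total_hellinger_bounded:
  obtains C where "\<And>T. (\<Sum>j<T. \<integral>\<omega>. total_hellinger (map \<omega> [0..<j]) \<partial>law) \<le> C"
proof -
  define x where "x j = (\<integral>\<omega>. (\<integral>a. hellinger (map \<omega> [0..<j]) a \<partial>\<pi> (map \<omega> [0..<j])) \<partial>law)" for j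
  have "\<exists>C. \<forall>T. (\<Sum>j | j < T \<and> (j + 1) mod N = n. x j) \<le> C" if "n < N" for n
    unfolding x_def by (rule sum_integral_hellinger_bounded[OF that]) blast
  then obtain C where C: "\<And>n T. n < N \<Longrightarrow> (\<Sum>j | j < T \<and> (j + 1) mod N = n. x j) \<le> C n"
    by metis
  have "(\<Sum>j<T. \<integral>\<omega>. total_hellinger (map \<omega> [0..<j]) \<partial>law) \<le> real CARD('a) / \<tau> * (\<Sum>n<N. C n)" for T
  proof -
    have "(\<Sum>j<T. \<integral>\<omega>. total_hellinger (map \<omega> [0..<j]) \<partial>law) \<le> (\<Sum>j<T. real CARD('a) / \<tau> * x j)"
    proof (rule sum_mono)
      fix j
      have "(\<integral>\<omega>. total_hellinger (map \<omega> [0..<j]) \<partial>law) \<le>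
          (\<integral>\<omega>. real CARD('a) / \<tau> * (\<integral>a. hellinger (map \<omega> [0..<j]) a \<partial>\<pi> (map \<omega> [0..<j])) \<partial>law)"
        using integrable_prefix[of \<pi> \<nu> "[]" "\<lambda>h. real CARD('a) / \<tau> * (\<integral>a. hellinger h a \<partial>\<pi> h)" j]
        by (intro integral_mono integrable_prefix total_hellinger_le)
      then show "(\<integral>\<omega>. total_hellinger (map \<omega> [0..<j]) \<partial>law) \<le> real CARD('a) / \<tau> * x j"
        by (simp add: x_def)
    qed
    also have "\<dots> = real CARD('a) / \<tau> * (\<Sum>j<T. x j)"
      by (rule sum_distrib_left[symmetric])
    \<comment> \<open>Every time belongs to exactly one phase, so the bounds for the finitely many
      phases add up.\<close>
    also have "(\<Sum>j<T. x j) = (\<Sum>n<N. \<Sum>j\<in>{j \<in> {..<T}. (j + 1) mod N = n}. x j)"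
      using N_pos by (intro sum.group[symmetric]) auto
    also have "real CARD('a) / \<tau> * \<dots> \<le> real CARD('a) / \<tau> * (\<Sum>n<N. C n)"
      using C \<tau>(1) by (intro mult_left_mono sum_mono) auto
    finally show ?thesis .
  qed
  then show ?thesis using that by blast
qed

text \<open>The prediction error enters symmetrically. The error of discretization and truncation is
  one-sided and appears only when the action value is bounded from above.\<close>

lemma action_value_bounds:
  assumes "0 < \<theta>"
  shows "Q_estimate M \<psi> h a \<le> action_value \<pi> \<nu> h a + total_hellinger h / (2 * \<theta>) + 4 * \<theta>"
    and "action_value \<pi> \<nu> h a \<le> Q_estimate M \<psi> h a + 1 / M + \<gamma> ^ H + total_hellinger h / (2 * \<theta>) + 4 * \<theta>"
proof -
  interpret act: prob_space "interaction_act \<pi> \<nu> h a" by (rule prob_space_interaction_act)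
  let ?E = "\<integral>\<omega>. disc \<omega> \<partial>interaction_act \<pi> \<nu> h a"
  have E: "?E = (\<Sum>z\<in>return_levels M. z * return_prob h a z)"
    by (rule integral_act_disc[where F = "\<lambda>z. z"])
  have "hellinger h a / (2 * \<theta>) \<le> total_hellinger h / (2 * \<theta>)"
    using assms by (intro divide_right_mono hellinger_le_total) auto
  then have Q: "\<bar>Q_estimate M \<psi> h a - ?E\<bar> \<le> total_hellinger h / (2 * \<theta>) + 4 * \<theta>"
    using expectation_diff_le[OF assms, of h a] unfolding E Q_estimate_def pred_prob_def by linarith
  have meas: "disc \<in> borel_measurable outcomes"
    by (rule measurable_discretized_return_fun[where F = "\<lambda>z. z"])
  have "\<bar>disc \<omega>\<bar> \<le> 1" for \<omega>
    by (rule abs_return_level_le[OF disc_in_levels])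
  then have int: "integrable (interaction_act \<pi> \<nu> h a) disc"
    unfolding interaction_act_def by (rule integrable_interaction[OF meas])
  have int': "integrable (interaction_act \<pi> \<nu> h a) (total_return rew \<gamma>)"
    unfolding interaction_act_def by (rule integrable_interaction[OF measurable_total_return abs_total_return_le])
  have "?E \<le> action_value \<pi> \<nu> h a"
    unfolding action_value_def by (intro integral_mono int int' discretized_return_bounds M)
  moreover have "action_value \<pi> \<nu> h a \<le> (\<integral>\<omega>. disc \<omega> + (1 / M + \<gamma> ^ H) \<partial>interaction_act \<pi> \<nu> h a)"
    unfolding action_value_def using discretized_return_bounds(2)[OF M]
    by (intro integral_mono int' Bochner_Integration.integrable_add int) (auto simp: add.assoc)
  moreover have "(\<integral>\<omega>. disc \<omega> + (1 / M + \<gamma> ^ H) \<partial>interaction_act \<pi> \<nu> h a) = ?E + (1 / M + \<gamma> ^ H)"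
    using int act.prob_space by (subst Bochner_Integration.integral_add) auto
  ultimately show "Q_estimate M \<psi> h a \<le> action_value \<pi> \<nu> h a + total_hellinger h / (2 * \<theta>) + 4 * \<theta>"
    and "action_value \<pi> \<nu> h a \<le> Q_estimate M \<psi> h a + 1 / M + \<gamma> ^ H + total_hellinger h / (2 * \<theta>) + 4 * \<theta>"
    using Q by linarith+
qed

text \<open>The estimate of a greedy action is at least that of \<open>a\<close>, so its true value
  falls short by at most two prediction errors, one for each of the two actions, and one
  discretization error. This accounts for \<open>8 * \<theta>\<close> and for
  \<open>total_hellinger h / \<theta>\<close>.\<close>

lemma action_value_gap:
  assumes "0 < \<theta>"
  shows "action_value \<pi> \<nu> h a - policy_value rew \<gamma> \<pi> \<nu> h \<le>
    (\<tau> + 1 / M + \<gamma> ^ H + 8 * \<theta>) + total_hellinger h / \<theta>"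
proof -
  obtain p where greedy: "set_pmf p \<subseteq> {a. \<forall>b. Q_estimate M \<psi> h b \<le> Q_estimate M \<psi> h a}"
    and p: "\<And>a. pmf (\<pi> h) a = (1 - \<tau>) * pmf p a + \<tau> / real CARD('a)"
    using aiqi_policy unfolding is_AIQI_policy_def by metis
  define x where "x = action_value \<pi> \<nu> h a - (1 / M + \<gamma> ^ H + 8 * \<theta> + total_hellinger h / \<theta>)"
  have two: "total_hellinger h / \<theta> = total_hellinger h / (2 * \<theta>) + total_hellinger h / (2 * \<theta>)"
    using assms by (simp add: field_simps)
  have x: "x \<le> action_value \<pi> \<nu> h b" if "b \<in> set_pmf p" for b
  proof -
    have "Q_estimate M \<psi> h a \<le> Q_estimate M \<psi> h b" using greedy that by auto
    then show ?thesis
      using action_value_bounds(2)[OF assms, of h a] action_value_bounds(1)[OF assms, of h b] two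
      unfolding x_def by linarith
  qed
  have nonneg: "0 \<le> action_value \<pi> \<nu> h b" for b
    unfolding action_value_def by (intro Bochner_Integration.integral_nonneg total_return_bounds)
  have "0 \<le> 1 / real M + \<gamma> ^ H + 8 * \<theta> + total_hellinger h / \<theta>"
    using \<gamma>_pos assms total_hellinger_nonneg by (intro add_nonneg_nonneg) auto
  then have "x \<le> 1" unfolding x_def using action_value_le_1[of \<pi> \<nu> h a] by linarith
  \<comment> \<open>Here the cost of exploration is found: giving up the fraction
    \<open>\<tau>\<close> of a value that is at most 1 loses at most \<open>\<tau>\<close>.\<close>
  then have "\<tau> * x \<le> \<tau>" using \<tau>(1) by simp
  then have "x - \<tau> \<le> (1 - \<tau>) * x" by (simp add: algebra_simps)
  also have "(1 - \<tau>) * x = (1 - \<tau>) * (\<Sum>b\<in>UNIV. x * pmf p b)"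
    by (simp add: sum_pmf_eq_1 flip: sum_distrib_left)
  also have "\<dots> \<le> (1 - \<tau>) * (\<Sum>b\<in>UNIV. action_value \<pi> \<nu> h b * pmf p b)"
  proof (intro mult_left_mono sum_mono)
    show "x * pmf p b \<le> action_value \<pi> \<nu> h b * pmf p b" for b
      using x[of b] by (cases "b \<in> set_pmf p") (auto simp: set_pmf_iff intro: mult_right_mono)
  qed (use \<tau> in auto)
  \<comment> \<open>The exploratory part of \<open>\<pi>\<close> contributes a nonnegative amount
    and is dropped.\<close>
  also have "\<dots> \<le> policy_value rew \<gamma> \<pi> \<nu> h"
    unfolding policy_value_eq p sum_distrib_left
    using \<tau>(1) nonneg by (intro sum_mono) (simp add: algebra_simps)
  finally show ?thesis unfolding x_def by linarith
qed

text \<open>The almost sure convergence concerns only the lookahead under \<open>\<pi>\<close>, so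
  the exceptional null set and the starting time do not depend on the competitor. This allows the
  supremum over all policies at the end.\<close>

lemma AE_optimality_gap:
  assumes "0 < \<theta>"
  shows "AE \<omega> in law. \<forall>\<^sub>F j in sequentially.
    optimal_value rew \<gamma> \<nu> (map \<omega> [0..<j]) - policy_value rew \<gamma> \<pi> \<nu> (map \<omega> [0..<j])
      \<le> (\<tau> + 1 / M + \<gamma> ^ H + 8 * \<theta>) / (1 - \<gamma>) + \<theta>"
proof -
  define c where "c = \<tau> + 1 / M + \<gamma> ^ H + 8 * \<theta>"
  define f where "f h = total_hellinger h / \<theta>" for h
  define L where "L = lookahead \<pi> \<nu> (\<gamma> / (\<tau> / real CARD('a))) f"
  have c: "0 \<le> c" unfolding c_def using \<tau> \<gamma>_pos assms by simp
  have f: "0 \<le> f h" for h unfolding f_def using assms total_hellinger_nonneg by simp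
  have \<delta>: "0 < \<tau> / real CARD('a)" using \<tau>(1) by simp
  then have \<beta>: "0 \<le> \<gamma> / (\<tau> / real CARD('a))" using \<gamma>_pos by (intro divide_nonneg_pos) auto
  \<comment> \<open>Half of the final \<open>\<theta>\<close> pays for the tail beyond
    \<open>K\<close> steps, the other half for the lookahead once it has become small.\<close>
  obtain K where K: "\<gamma> ^ K < \<theta> / 2"
    using real_arch_pow_inv[of "\<theta> / 2" \<gamma>] assms \<gamma>_less_1 by auto
  have "(\<Sum>k<K. \<gamma> ^ k) \<le> 1 / (1 - \<gamma>)"
    using \<gamma>_pos \<gamma>_less_1 by (simp add: sum_gp_strict divide_right_mono)
  then have geo: "c * (\<Sum>k<K. \<gamma> ^ k) \<le> c / (1 - \<gamma>)"
    using mult_left_mono[OF _ c] by fastforce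
  obtain C where C: "\<And>T. (\<Sum>j<T. \<integral>\<omega>. total_hellinger (map \<omega> [0..<j]) \<partial>law) \<le> C"
    using sum_integral_total_hellinger_bounded by blast
  have "(\<Sum>j<T. \<integral>\<omega>. f (map \<omega> [0..<j]) \<partial>law) \<le> C / \<theta>" for T
    using divide_right_mono[OF C[of T], of \<theta>] assms by (simp add: f_def sum_divide_distrib)
  from sum_integral_lookahead_bounded[OF \<beta> f this, of K] obtain C' where
    C': "\<And>T. (\<Sum>j<T. \<integral>\<omega>. L K (map \<omega> [0..<j]) \<partial>law) \<le> C'"
    unfolding L_def by blast
  have "0 \<le> L K h" for h unfolding L_def by (rule lookahead_nonneg[OF \<beta> f])
  from AE_tendsto_zero[of "L K", OF this C'] show ?thesis
  proof eventually_elim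
    case (elim \<omega>)
    have "\<forall>\<^sub>F j in sequentially. L K (map \<omega> [0..<j]) < \<theta> / 2"
      using assms by (intro order_tendstoD(2)[OF elim]) simp
    then show ?case
    proof eventually_elim
      case (elim j)
      let ?h = "map \<omega> [0..<j]"
      have "policy_value rew \<gamma> \<pi>' \<nu> ?h \<le> policy_value rew \<gamma> \<pi> \<nu> ?h + c / (1 - \<gamma>) + \<theta>" for \<pi>'
        using policy_value_diff_le[of "\<tau> / real CARD('a)" \<pi> f \<nu> c \<pi>' ?h K, OF \<delta> exploration f]
          action_value_gap[OF assms] elim K geo
        unfolding c_def f_def L_def by fastforce
      then have "optimal_value rew \<gamma> \<nu> ?h \<le> policy_value rew \<gamma> \<pi> \<nu> ?h + c / (1 - \<gamma>) + \<theta>"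
        unfolding optimal_value_def by (intro cSUP_least) auto
      then show ?case unfolding c_def by linarith
    qed
  qed
qed

end

text \<open>The tail of the geometric series from \<open>H\<close> on, normalised by
  \<open>1 - \<gamma>\<close>, is exactly \<open>\<gamma> ^ H\<close>, so the defining condition of
  the least horizon is the claim, once some horizon satisfies it.\<close>

lemma effective_horizon:
  assumes "0 < \<gamma>" "\<gamma> < 1" "0 < \<eta>"
  shows "\<gamma> ^ effective_horizon \<gamma> \<eta> \<le> \<eta>"
proof -
  have tail: "(1 - \<gamma>) * (\<Sum>k. \<gamma> ^ (k + H)) = \<gamma> ^ H" for H
    using assms by (simp add: power_add suminf_mult2[OF summable_geometric, symmetric] suminf_geometric)
  obtain H where "\<gamma> ^ H < \<eta>"
    using real_arch_pow_inv[of \<eta> \<gamma>] assms by auto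
  moreover have "\<gamma> ^ Suc H \<le> \<gamma> ^ H" using assms by (intro power_decreasing) auto
  \<comment> \<open>The witness is \<open>Suc H\<close> rather than \<open>H\<close>, because the
    horizon must be positive.\<close>
  ultimately have "1 \<le> Suc H \<and> (1 - \<gamma>) * (\<Sum>k. \<gamma> ^ (k + Suc H)) \<le> \<eta>" unfolding tail by simp
  from LeastI[of "\<lambda>H. 1 \<le> H \<and> (1 - \<gamma>) * (\<Sum>k. \<gamma> ^ (k + H)) \<le> \<eta>", OF this]
  show ?thesis unfolding effective_horizon_def tail by blast
qed

theorem theorem14:
  fixes rew :: "'r::finite \<Rightarrow> real"
    and \<gamma> \<epsilon> \<tau> \<eta> :: real
    and H M N :: nat
    and \<M> :: "('a::finite, 'o::finite, 'r) environment set"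
    and P :: "nat \<Rightarrow> ('a, 'o, 'r) predictor set"
    and w :: "nat \<Rightarrow> ('a, 'o, 'r) predictor \<Rightarrow> real"
    and \<psi>s :: "nat \<Rightarrow> ('a, 'o, 'r) predictor"
    and \<psi> :: "('a, 'o, 'r) history \<Rightarrow> 'a \<Rightarrow> real pmf"
    and \<pi> :: "('a, 'o, 'r) policy"
  assumes rewards: "inj rew" "range rew \<subseteq> {0..1}"
    and discount: "0 < \<gamma>" "\<gamma> < 1"
    and parameters: "1 \<le> H" "1 \<le> M" "H \<le> N" "0 < \<tau>" "\<tau> \<le> 1"
    and eps: "0 < \<epsilon>"
    and tau: "\<tau> \<le> \<epsilon> * (1 - \<gamma>) / 10"
    and levels: "real M \<ge> 10 / (\<epsilon> * (1 - \<gamma>))"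
    and horizon: "0 < \<eta>" "\<eta> \<le> \<epsilon> * (1 - \<gamma>) / 10" "H = effective_horizon \<gamma> \<eta>"
    and period: "real N \<ge> real H + log \<gamma> (\<epsilon> / 5)"
    and classes: "\<And>n. n < N \<Longrightarrow> predictor_class M N n (P n) (w n)"
    and mixtures: "\<And>n. n < N \<Longrightarrow> is_mixture M N n (P n) (w n) (\<psi>s n)"
    and unified: "\<psi> = unified_predictor rew \<gamma> H M N \<psi>s"
    and aiqi: "is_AIQI_policy M \<tau> \<psi> \<pi>"
    and grain: "\<And>\<nu>. \<nu> \<in> \<M> \<Longrightarrow> grain_of_truth rew \<gamma> H M N P \<pi> \<nu>"
  shows "strong_asymptotically_optimal rew \<gamma> \<epsilon> \<M> \<pi>"
proof -
  have \<gamma>1: "0 < 1 - \<gamma>" using discount by simp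
  \<comment> \<open>With 80, the term \<open>8 * \<theta>\<close> gets the same share
    \<open>\<epsilon> * (1 - \<gamma>) / 10\<close> that bounds \<open>\<tau>\<close>,
    \<open>1 / M\<close> and \<open>\<gamma> ^ H\<close>. Dividing the four shares by
    \<open>1 - \<gamma>\<close> gives \<open>4 * \<epsilon> / 10\<close>, and the separate
    \<open>\<theta>\<close> is at most \<open>\<epsilon> / 10\<close>.\<close>
  define \<theta> where "\<theta> = \<epsilon> * (1 - \<gamma>) / 80"
  have \<theta>: "0 < \<theta>" using eps \<gamma>1 by (simp add: \<theta>_def)
  have "AE \<omega> in interaction \<pi> \<nu> [].
      limsup (\<lambda>t. ereal (optimal_value rew \<gamma> \<nu> (history_before \<omega> t)
        - policy_value rew \<gamma> \<pi> \<nu> (history_before \<omega> t))) \<le> ereal \<epsilon>" if \<nu>: "\<nu> \<in> \<M>" for \<nu>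
  proof -
    interpret aiqi rew \<gamma> H M N \<pi> \<nu> P w \<psi>s \<psi> \<tau>
      using assms grain[OF \<nu>] by unfold_locales auto
    have "\<gamma> ^ H \<le> \<epsilon> * (1 - \<gamma>) / 10"
      using effective_horizon[OF discount horizon(1)] horizon(2,3) by simp
    moreover have "1 / M \<le> \<epsilon> * (1 - \<gamma>) / 10"
      using levels parameters(2) eps \<gamma>1 by (simp add: field_simps)
    ultimately have "\<tau> + 1 / M + \<gamma> ^ H + 8 * \<theta> \<le> 4 * (\<epsilon> * (1 - \<gamma>) / 10)"
      using tau unfolding \<theta>_def by linarith
    then have "(\<tau> + 1 / M + \<gamma> ^ H + 8 * \<theta>) / (1 - \<gamma>) \<le> 4 * \<epsilon> / 10"
      using \<gamma>1 by (simp add: divide_le_eq)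
    moreover have "\<theta> \<le> \<epsilon> / 10"
      using eps discount mult_left_mono[of "1 - \<gamma>" 1 \<epsilon>] by (simp add: \<theta>_def)
    ultimately have le: "(\<tau> + 1 / M + \<gamma> ^ H + 8 * \<theta>) / (1 - \<gamma>) + \<theta> \<le> \<epsilon>"
      using eps by linarith
    from AE_optimality_gap[OF \<theta>] show ?thesis
    proof eventually_elim
      case (elim \<omega>)
      \<comment> \<open>Time is 1-based, so the history before \<open>t\<close> has
        \<open>t - 1\<close> blocks. The shift is harmless because \<open>t - 1\<close> still tends
        to infinity.\<close>
      have "\<forall>\<^sub>F t in sequentially. optimal_value rew \<gamma> \<nu> (map \<omega> [0..<t - 1]) - policy_value rew \<gamma> \<pi> \<nu> (map \<omega> [0..<t - 1])
          \<le> (\<tau> + 1 / M + \<gamma> ^ H + 8 * \<theta>) / (1 - \<gamma>) + \<theta>"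
        by (rule eventually_compose_filterlim[OF elim filterlim_minus_const_nat_at_top])
      then show ?case
        unfolding history_before_def
        by (intro Limsup_bounded) (auto elim!: eventually_mono intro: order.trans[OF _ le])
    qed
  qed
  then show ?thesis unfolding strong_asymptotically_optimal_def by blast
qed

end
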